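(* If $\delta$ is supreme for tallness, then for every uncountable regular cardinal $\eta\le\delta$, $\mathrm{ULST}(\mathcal L_{\eta,\eta})$ exists and is at most $\delta$. In particular, if $\delta$ is regular, then $\mathrm{ULST}(\mathcal L_{\delta,\delta})=\delta$.
   Context: $\mathcal L_{\eta,\eta}$ is the infinitary logic with conjunctions/disjunctions of fewer than $\eta$ formulas and quantification over fewer than $\eta$ variables. For cardinals $\kappa\le\delta$ and $\lambda\le\kappa$, $\kappa$ is $\theta$-tall pushing up $\delta$ with closure $\lambda$ if there is an elementary embedding $j:V\to M$ ($M$ transitive) with critical point $\kappa$, $M^\lambda\subseteq M$ and $j(\delta)>\theta$. A cardinal $\delta$ is supreme for tallness if for all $\lambda<\delta$ and all ordinals $\theta$ there is a cardinal $\kappa$ with $\lambda<\kappa\le\delta$ that is $\theta$-tall pushing up $\delta$ with closure $\lambda$. $\mathrm{ULST}(\mathcal L)$ is the least cardinal $\delta$ such that for every language $\tau$, every $\mathcal L(\tau)$-sentence $\varphi$, every $\tau$-structure $M\models_{\mathcal L}\varphi$ with $|M|=\gamma\ge\delta$ and every cardinal $\bar\gamma>\gamma$, there is a $\tau$-structure $\bar M\models_{\mathcal L}\varphi$ of size $\ge\bar\gamma$ with $M$ a substructure of $\bar M$. *)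

theory Defs
  imports Main "HOL-Library.Equipollence" "HOL-Library.Countable_Set"
begin

section \<open>The set-theoretic universe\<close>

text \<open>
  A type of this class plays the role of the universe V of ZFC. A HOL set of such
  objects is a class; it is a set in the sense of ZFC iff it lies in the range of
  \<open>elts\<close>. Separation and Replacement hold for all HOL predicates and functions, and
  Choice is inherited from HOL. Pairing follows from \<open>infinity\<close>, which says that every
  countable class is a set.
\<close>

class zfc_universe =
  fixes elts :: "'a \<Rightarrow> 'a set"
  assumes extensionality: "elts x = elts y \<Longrightarrow> x = y"
    and foundation: "wf {(x, y). x \<in> elts y}"
    and separation: "A \<subseteq> elts x \<Longrightarrow> A \<in> range elts"
    and union: "(\<Union>y \<in> elts x. elts y) \<in> range elts"
    and power_set: "{y. elts y \<subseteq> elts x} \<in> range elts"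
    and replacement: "f ` elts x \<in> range elts"
    and infinity: "range (g :: nat \<Rightarrow> 'a) \<in> range elts"

text \<open>Meaningful only if the class \<open>A\<close> is a set.\<close>

definition mkset :: "'v::zfc_universe set \<Rightarrow> 'v" where
  "mkset A = (THE x. elts x = A)"

lemma elts_mkset:
  fixes A :: "'v::zfc_universe set"
  assumes "A \<in> range elts"
  shows "elts (mkset A) = A"
proof -
  obtain x where x: "elts x = A" using assms by auto
  then have "mkset A = x"
    unfolding mkset_def by (intro the_equality) (auto intro: extensionality)
  with x show ?thesis by simp
qed

definition kpair :: "'v::zfc_universe \<Rightarrow> 'v \<Rightarrow> 'v" where
  "kpair x y = mkset {mkset {x}, mkset {x, y}}"

lemma elts_mkset_doubleton: "elts (mkset {x, y}) = {x, y :: 'v::zfc_universe}"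
proof (rule elts_mkset)
  have "range (\<lambda>n::nat. if n = 0 then x else y) = {x, y}"
    by (auto split: if_splits)
  then show "{x, y} \<in> range elts"
    using infinity[of "\<lambda>n. if n = 0 then x else y"] by simp
qed

lemma kpair_inject: "kpair x y = kpair x' y' \<longleftrightarrow> x = x' \<and> y = (y' :: 'v::zfc_universe)"
proof -
  have mk: "mkset {a, b} = mkset {c, d} \<longleftrightarrow> {a, b} = {c, d}" for a b c d :: 'v
    by (metis elts_mkset_doubleton)
  have mk1: "mkset {a} = mkset {c, d} \<longleftrightarrow> {a} = {c, d}"
    "mkset {c, d} = mkset {a} \<longleftrightarrow> {c, d} = {a}" for a c d :: 'v
    using mk[of a a c d] mk[of c d a a] by simp_all
  have mk2: "mkset {a} = mkset {c} \<longleftrightarrow> a = c" for a c :: 'v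
    using mk[of a a c c] by simp
  show ?thesis
    unfolding kpair_def mk by (auto simp: doubleton_eq_iff mk mk1 mk2)
qed

section \<open>Ordinals and cardinals\<close>

definition transitive_set :: "'v::zfc_universe \<Rightarrow> bool" where
  "transitive_set x \<longleftrightarrow> (\<forall>y \<in> elts x. elts y \<subseteq> elts x)"

definition Ordinal :: "'v::zfc_universe \<Rightarrow> bool" where
  "Ordinal \<alpha> \<longleftrightarrow> transitive_set \<alpha> \<and> (\<forall>\<beta> \<in> elts \<alpha>. transitive_set \<beta>)"

text \<open>On ordinals, \<open>\<alpha> < \<beta>\<close> is written \<open>\<alpha> \<in> elts \<beta>\<close>.\<close>

definition ord_le :: "'v::zfc_universe \<Rightarrow> 'v \<Rightarrow> bool" where
  "ord_le \<alpha> \<beta> \<longleftrightarrow> \<alpha> \<in> elts \<beta> \<or> \<alpha> = \<beta>"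

definition Cardinal :: "'v::zfc_universe \<Rightarrow> bool" where
  "Cardinal \<kappa> \<longleftrightarrow> Ordinal \<kappa> \<and> (\<forall>\<alpha> \<in> elts \<kappa>. \<not> elts \<alpha> \<approx> elts \<kappa>)"

definition regular_cardinal :: "'v::zfc_universe \<Rightarrow> bool" where
  "regular_cardinal \<kappa> \<longleftrightarrow> Cardinal \<kappa> \<and> infinite (elts \<kappa>) \<and>
     (\<forall>X. X \<subseteq> elts \<kappa> \<and> X \<prec> elts \<kappa> \<longrightarrow> (\<exists>\<beta> \<in> elts \<kappa>. X \<subseteq> elts \<beta>))"

section \<open>Elementary embeddings of the universe\<close>

text \<open>First-order formulas in the language of set theory, with variables \<open>nat\<close>.\<close>

datatype set_fm =
    SMem nat nat
  | SEq nat nat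
  | SNeg set_fm
  | SConj set_fm set_fm
  | SEx nat set_fm

primrec set_sat :: "'v::zfc_universe set \<Rightarrow> (nat \<Rightarrow> 'v) \<Rightarrow> set_fm \<Rightarrow> bool" where
  "set_sat M s (SMem m n) \<longleftrightarrow> s m \<in> elts (s n)"
| "set_sat M s (SEq m n) \<longleftrightarrow> s m = s n"
| "set_sat M s (SNeg \<phi>) \<longleftrightarrow> \<not> set_sat M s \<phi>"
| "set_sat M s (SConj \<phi> \<psi>) \<longleftrightarrow> set_sat M s \<phi> \<and> set_sat M s \<psi>"
| "set_sat M s (SEx n \<phi>) \<longleftrightarrow> (\<exists>x \<in> M. set_sat M (s(n := x)) \<phi>)"

definition transitive_class :: "'v::zfc_universe set \<Rightarrow> bool" where
  "transitive_class M \<longleftrightarrow> (\<forall>x \<in> M. elts x \<subseteq> M)"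

definition elementary_embedding :: "('v::zfc_universe \<Rightarrow> 'v) \<Rightarrow> 'v set \<Rightarrow> bool" where
  "elementary_embedding j M \<longleftrightarrow> range j \<subseteq> M \<and>
     (\<forall>\<phi> s. set_sat UNIV s \<phi> \<longleftrightarrow> set_sat M (j \<circ> s) \<phi>)"

definition critical_point :: "('v::zfc_universe \<Rightarrow> 'v) \<Rightarrow> 'v \<Rightarrow> bool" where
  "critical_point j \<kappa> \<longleftrightarrow> Ordinal \<kappa> \<and> j \<kappa> \<noteq> \<kappa> \<and> (\<forall>\<alpha> \<in> elts \<kappa>. j \<alpha> = \<alpha>)"

text \<open>\<open>M\<^sup>\<lambda> \<subseteq> M\<close>: the graph of every function from \<open>\<lambda>\<close> to \<open>M\<close> is an element of \<open>M\<close>.\<close>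

definition closed_under_sequences :: "'v::zfc_universe set \<Rightarrow> 'v \<Rightarrow> bool" where
  "closed_under_sequences M l \<longleftrightarrow>
     (\<forall>f. f ` elts l \<subseteq> M \<longrightarrow> mkset ((\<lambda>\<alpha>. kpair \<alpha> (f \<alpha>)) ` elts l) \<in> M)"

definition tall_pushing_up :: "'v::zfc_universe \<Rightarrow> 'v \<Rightarrow> 'v \<Rightarrow> 'v \<Rightarrow> bool" where
  "tall_pushing_up \<theta> \<kappa> \<delta> l \<longleftrightarrow>
     Ordinal \<theta> \<and> Cardinal \<kappa> \<and> Cardinal \<delta> \<and> Cardinal l \<and> ord_le \<kappa> \<delta> \<and> ord_le l \<kappa> \<and>
     (\<exists>j M. transitive_class M \<and> elementary_embedding j M \<and> critical_point j \<kappa> \<and>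
        closed_under_sequences M l \<and> \<theta> \<in> elts (j \<delta>))"

definition supreme_for_tallness :: "'v::zfc_universe \<Rightarrow> bool" where
  "supreme_for_tallness \<delta> \<longleftrightarrow> Cardinal \<delta> \<and>
     (\<forall>l \<theta>. Cardinal l \<and> l \<in> elts \<delta> \<and> Ordinal \<theta> \<longrightarrow>
        (\<exists>\<kappa>. Cardinal \<kappa> \<and> l \<in> elts \<kappa> \<and> ord_le \<kappa> \<delta> \<and> tall_pushing_up \<theta> \<kappa> \<delta> l))"

section \<open>Languages and structures\<close>

text \<open>
  Languages have a set of relation symbols and a set of function symbols, each with a
  finite arity; constants are function symbols of arity 0.
\<close>

record 'v language =
  rel_syms :: 'v
  fun_syms :: 'v
  rel_arity :: "'v \<Rightarrow> nat"
  fun_arity :: "'v \<Rightarrow> nat"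

record 'v struct =
  universe :: 'v
  rel_int :: "'v \<Rightarrow> 'v list \<Rightarrow> bool"
  fun_int :: "'v \<Rightarrow> 'v list \<Rightarrow> 'v"

text \<open>
  Interpretations of foreign symbols, or at tuples of the wrong length or outside the
  universe, are irrelevant to all notions below.
\<close>

definition tuples :: "'v::zfc_universe struct \<Rightarrow> nat \<Rightarrow> 'v list set" where
  "tuples A n = {xs. length xs = n \<and> set xs \<subseteq> elts (universe A)}"

definition is_structure :: "'v::zfc_universe language \<Rightarrow> 'v struct \<Rightarrow> bool" where
  "is_structure \<tau> A \<longleftrightarrow> elts (universe A) \<noteq> {} \<and>
     (\<forall>f \<in> elts (fun_syms \<tau>). \<forall>xs \<in> tuples A (fun_arity \<tau> f). fun_int A f xs \<in> elts (universe A))"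

definition substructure :: "'v::zfc_universe language \<Rightarrow> 'v struct \<Rightarrow> 'v struct \<Rightarrow> bool" where
  "substructure \<tau> A B \<longleftrightarrow> elts (universe A) \<subseteq> elts (universe B) \<and>
     (\<forall>r \<in> elts (rel_syms \<tau>). \<forall>xs \<in> tuples A (rel_arity \<tau> r). rel_int A r xs = rel_int B r xs) \<and>
     (\<forall>f \<in> elts (fun_syms \<tau>). \<forall>xs \<in> tuples A (fun_arity \<tau> f). fun_int A f xs = fun_int B f xs)"

section \<open>The infinitary logics\<close>

text \<open>
  Variables are arbitrary sets. \<open>Conj I F\<close> is the conjunction of the family of
  formulas \<open>F i\<close> for \<open>i \<in> I\<close> (values of \<open>F\<close> outside \<open>I\<close> are irrelevant), and
  \<open>Exists X \<phi>\<close> binds all variables in \<open>X\<close> simultaneously; dually for \<open>Disj\<close> and \<open>Forall\<close>.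
\<close>

datatype 'v trm = Var 'v | App 'v "'v trm list"

datatype 'v fm =
    Eq "'v trm" "'v trm"
  | Rel 'v "'v trm list"
  | Neg "'v fm"
  | Conj "'v set" "'v \<Rightarrow> 'v fm"
  | Disj "'v set" "'v \<Rightarrow> 'v fm"
  | Exists "'v set" "'v fm"
  | Forall "'v set" "'v fm"

fun trm_vars :: "'v trm \<Rightarrow> 'v set" where
  "trm_vars (Var x) = {x}"
| "trm_vars (App f ts) = (\<Union>t \<in> set ts. trm_vars t)"

primrec free_vars :: "'v fm \<Rightarrow> 'v set" where
  "free_vars (Eq t u) = trm_vars t \<union> trm_vars u"
| "free_vars (Rel r ts) = (\<Union>t \<in> set ts. trm_vars t)"
| "free_vars (Neg \<phi>) = free_vars \<phi>"
| "free_vars (Conj I F) = (\<Union>i \<in> I. free_vars (F i))"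
| "free_vars (Disj I F) = (\<Union>i \<in> I. free_vars (F i))"
| "free_vars (Exists X \<phi>) = free_vars \<phi> - X"
| "free_vars (Forall X \<phi>) = free_vars \<phi> - X"

fun wf_trm :: "'v::zfc_universe language \<Rightarrow> 'v trm \<Rightarrow> bool" where
  "wf_trm \<tau> (Var x) \<longleftrightarrow> True"
| "wf_trm \<tau> (App f ts) \<longleftrightarrow>
     f \<in> elts (fun_syms \<tau>) \<and> length ts = fun_arity \<tau> f \<and> (\<forall>t \<in> set ts. wf_trm \<tau> t)"

text \<open>\<open>wf_fm \<eta> \<tau> \<phi>\<close>: \<open>\<phi>\<close> is a formula of the logic with parameters \<open>\<eta>, \<eta>\<close> in the language \<open>\<tau>\<close>.\<close>

primrec wf_fm :: "'v::zfc_universe \<Rightarrow> 'v language \<Rightarrow> 'v fm \<Rightarrow> bool" where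
  "wf_fm \<eta> \<tau> (Eq t u) \<longleftrightarrow> wf_trm \<tau> t \<and> wf_trm \<tau> u"
| "wf_fm \<eta> \<tau> (Rel r ts) \<longleftrightarrow>
     r \<in> elts (rel_syms \<tau>) \<and> length ts = rel_arity \<tau> r \<and> (\<forall>t \<in> set ts. wf_trm \<tau> t)"
| "wf_fm \<eta> \<tau> (Neg \<phi>) \<longleftrightarrow> wf_fm \<eta> \<tau> \<phi>"
| "wf_fm \<eta> \<tau> (Conj I F) \<longleftrightarrow> I \<prec> elts \<eta> \<and> (\<forall>i \<in> I. wf_fm \<eta> \<tau> (F i))"
| "wf_fm \<eta> \<tau> (Disj I F) \<longleftrightarrow> I \<prec> elts \<eta> \<and> (\<forall>i \<in> I. wf_fm \<eta> \<tau> (F i))"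
| "wf_fm \<eta> \<tau> (Exists X \<phi>) \<longleftrightarrow> X \<prec> elts \<eta> \<and> wf_fm \<eta> \<tau> \<phi>"
| "wf_fm \<eta> \<tau> (Forall X \<phi>) \<longleftrightarrow> X \<prec> elts \<eta> \<and> wf_fm \<eta> \<tau> \<phi>"

definition L_sentences :: "'v::zfc_universe \<Rightarrow> 'v language \<Rightarrow> 'v fm set" where
  "L_sentences \<eta> \<tau> = {\<phi>. wf_fm \<eta> \<tau> \<phi> \<and> free_vars \<phi> = {}}"

primrec trm_val :: "'v struct \<Rightarrow> ('v \<Rightarrow> 'v) \<Rightarrow> 'v trm \<Rightarrow> 'v" where
  "trm_val A s (Var x) = s x"
| "trm_val A s (App f ts) = fun_int A f (map (trm_val A s) ts)"

primrec sat :: "'v::zfc_universe struct \<Rightarrow> 'v fm \<Rightarrow> ('v \<Rightarrow> 'v) \<Rightarrow> bool" where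
  "sat A (Eq t u) s \<longleftrightarrow> trm_val A s t = trm_val A s u"
| "sat A (Rel r ts) s \<longleftrightarrow> rel_int A r (map (trm_val A s) ts)"
| "sat A (Neg \<phi>) s \<longleftrightarrow> \<not> sat A \<phi> s"
| "sat A (Conj I F) s \<longleftrightarrow> (\<forall>i \<in> I. sat A (F i) s)"
| "sat A (Disj I F) s \<longleftrightarrow> (\<exists>i \<in> I. sat A (F i) s)"
| "sat A (Exists X \<phi>) s \<longleftrightarrow> (\<exists>t. t ` X \<subseteq> elts (universe A) \<and> sat A \<phi> (override_on s t X))"
| "sat A (Forall X \<phi>) s \<longleftrightarrow> (\<forall>t. t ` X \<subseteq> elts (universe A) \<longrightarrow> sat A \<phi> (override_on s t X))"

definition L_models :: "'v::zfc_universe struct \<Rightarrow> 'v fm \<Rightarrow> bool" where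
  "L_models A \<phi> \<longleftrightarrow> (\<forall>s. range s \<subseteq> elts (universe A) \<longrightarrow> sat A \<phi> s)"

section \<open>Upward Loewenheim-Skolem-Tarski numbers\<close>

text \<open>
  An abstract logic is given by its set of sentences in each language and its
  satisfaction relation between structures and sentences.
\<close>

definition ULST_property ::
  "('v::zfc_universe language \<Rightarrow> 'f set) \<Rightarrow> ('v struct \<Rightarrow> 'f \<Rightarrow> bool) \<Rightarrow> 'v \<Rightarrow> bool" where
  "ULST_property Sent Mod \<delta> \<longleftrightarrow>
     (\<forall>\<tau> \<phi> A \<gamma> \<gamma>'. \<phi> \<in> Sent \<tau> \<and> is_structure \<tau> A \<and> Mod A \<phi> \<and>
        Cardinal \<gamma> \<and> elts (universe A) \<approx> elts \<gamma> \<and> ord_le \<delta> \<gamma> \<and> Cardinal \<gamma>' \<and> \<gamma> \<in> elts \<gamma>' \<longrightarrow>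
        (\<exists>B. is_structure \<tau> B \<and> Mod B \<phi> \<and> elts \<gamma>' \<lesssim> elts (universe B) \<and> substructure \<tau> A B))"

text \<open>\<open>is_ULST Sent Mod \<mu>\<close>: the number of the logic exists and equals \<open>\<mu>\<close>.\<close>

definition is_ULST ::
  "('v::zfc_universe language \<Rightarrow> 'f set) \<Rightarrow> ('v struct \<Rightarrow> 'f \<Rightarrow> bool) \<Rightarrow> 'v \<Rightarrow> bool" where
  "is_ULST Sent Mod \<mu> \<longleftrightarrow> Cardinal \<mu> \<and> ULST_property Sent Mod \<mu> \<and>
     (\<forall>\<nu>. Cardinal \<nu> \<and> ULST_property Sent Mod \<nu> \<longrightarrow> ord_le \<mu> \<nu>)"

end

theory Submission
  imports Defs
begin

text \<open>
  Given a sentence \<open>\<phi>\<close> of the logic with parameters \<open>\<eta>, \<eta>\<close>, regularity of \<open>\<eta>\<close> yields a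
  cardinal \<open>l < \<eta>\<close> bounding all index sets and the number of variables of \<open>\<phi>\<close>. Take
  \<open>j : V \<rightarrow> M\<close> with critical point above \<open>l\<close>, with \<open>M\<close> closed under \<open>l\<close>-sequences and
  \<open>\<gamma>' < j \<delta>\<close>. Then \<open>j A\<close>, with a symbol \<open>r\<close> read as \<open>j r\<close>, extends \<open>A\<close> up to isomorphism and
  has size at least \<open>|j \<delta>|\<close>. Formulas need not be coded as sets: an assignment is an
  \<open>l\<close>-sequence, \<open>M\<close> contains all \<open>l\<close>-sequences in \<open>j A\<close>, and for the set \<open>S \<psi>\<close> of
  assignments satisfying a subformula \<open>\<psi>\<close> in \<open>A\<close>, an induction on \<open>\<psi>\<close> shows that \<open>j (S \<psi>)\<close> is the
  set of assignments satisfying \<open>\<psi>\<close> in \<open>j A\<close>, since \<open>j\<close> commutes with complements, with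
  intersections and unions of at most \<open>l\<close> sets, and with projections.
\<close>

section \<open>Sets, functions and tuples in the universe\<close>

abbreviation is_set :: "'v::zfc_universe set \<Rightarrow> bool" where
  "is_set A \<equiv> A \<in> range elts"

lemma is_set_subset: "A \<subseteq> elts x \<Longrightarrow> is_set A"
  by (rule separation)

lemma is_setE:
  assumes "is_set A"
  obtains x where "elts x = A"
  using assms by auto

text \<open>Replacement collects the codes \<open>mkset (f a)\<close> into a set, and the union
  axiom flattens it.\<close>

lemma is_set_UN:
  fixes f :: "'v::zfc_universe \<Rightarrow> 'v set"
  assumes "\<And>a. a \<in> elts x \<Longrightarrow> is_set (f a)"
  shows "is_set (\<Union>a\<in>elts x. f a)"
proof -
  obtain y where y: "elts y = (\<lambda>a. mkset (f a)) ` elts x"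
    using is_setE[OF replacement[of "\<lambda>a. mkset (f a)" x]] by blast
  have "(\<Union>a\<in>elts x. f a) = (\<Union>z\<in>elts y. elts z)"
    using assms by (auto simp: y elts_mkset)
  then show ?thesis
    by (simp only: union)
qed

lemma is_set_doubleton: "is_set {a, b}"
  using rangeI[of elts "mkset {a, b}"] by (simp only: elts_mkset_doubleton)

lemma is_set_singleton: "is_set {a}"
  using is_set_doubleton[of a a] by simp

lemma is_set_empty: "is_set {}"
  by (rule is_set_subset[of _ undefined]) simp

lemma mem_irrefl: "x \<notin> elts x"
  using wf_not_refl[OF foundation] by auto

lemma elts_kpair: "elts (kpair x y) = {mkset {x}, mkset {x, y}}"
  unfolding kpair_def by (rule elts_mkset_doubleton)

text \<open>Otherwise x \<in> {x} \<in> (x, y) \<in> x would be a membership cycle. Pairs with first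
  component \<open>universe A\<close> thus supply new elements outside \<open>A\<close>.\<close>

lemma kpair_notin_first: "kpair x y \<notin> elts x"
proof
  assume h: "kpair x y \<in> elts x"
  let ?a = "mkset {x}"
  have "?a \<in> elts (kpair x y)" "x \<in> elts ?a"
    by (simp_all add: elts_kpair elts_mkset is_set_singleton)
  with h have "(x, ?a) \<in> {(x, y). x \<in> elts y}" "(?a, kpair x y) \<in> {(x, y). x \<in> elts y}"
    "(kpair x y, x) \<in> {(x, y). x \<in> elts y}"
    by simp_all
  then have "(x, x) \<in> {(x, y). x \<in> elts y}\<^sup>+"
    by (meson trancl.simps)
  then show False
    using wf_trancl[OF foundation] wf_not_refl by metis
qed

section \<open>Products and functions as sets of ordered pairs\<close>

definition cart :: "'v::zfc_universe \<Rightarrow> 'v \<Rightarrow> 'v" where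
  "cart x y = mkset (\<Union>a\<in>elts x. kpair a ` elts y)"

lemma elts_cart: "elts (cart x y) = (\<Union>a\<in>elts x. kpair a ` elts y)"
  unfolding cart_def by (intro elts_mkset is_set_UN replacement)

text \<open>Every quantifier is bounded by \<open>f\<close>, \<open>x\<close> or \<open>y\<close>,
  which makes the notion absolute for transitive classes.\<close>

definition is_fun :: "'v::zfc_universe \<Rightarrow> 'v \<Rightarrow> 'v \<Rightarrow> bool" where
  "is_fun f x y \<longleftrightarrow>
     (\<forall>p\<in>elts f. \<exists>a\<in>elts x. \<exists>b\<in>elts y. p = kpair a b) \<and>
     (\<forall>a\<in>elts x. \<exists>b\<in>elts y. kpair a b \<in> elts f) \<and>
     (\<forall>a\<in>elts x. \<forall>b\<in>elts y. \<forall>c\<in>elts y. kpair a b \<in> elts f \<longrightarrow> kpair a c \<in> elts f \<longrightarrow> b = c)"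

definition ap :: "'v::zfc_universe \<Rightarrow> 'v \<Rightarrow> 'v" where
  "ap f a = (THE b. kpair a b \<in> elts f)"

definition lam :: "'v::zfc_universe \<Rightarrow> ('v \<Rightarrow> 'v) \<Rightarrow> 'v" where
  "lam x g = mkset ((\<lambda>a. kpair a (g a)) ` elts x)"

lemma elts_lam: "elts (lam x g) = (\<lambda>a. kpair a (g a)) ` elts x"
  unfolding lam_def by (intro elts_mkset replacement)

lemma is_fun_lam: "is_fun (lam x g) x y \<longleftrightarrow> g ` elts x \<subseteq> elts y"
  unfolding is_fun_def elts_lam by (auto simp: kpair_inject image_iff)

lemma ap_lam: "a \<in> elts x \<Longrightarrow> ap (lam x g) a = g a"
  unfolding ap_def elts_lam by (auto simp: kpair_inject)

lemma is_fun_unique: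
  assumes "is_fun f x y" "kpair a b \<in> elts f" "kpair a c \<in> elts f"
  shows "b = c"
proof -
  from assms have "a \<in> elts x" "b \<in> elts y" "c \<in> elts y"
    unfolding is_fun_def by (metis kpair_inject)+
  with assms show ?thesis
    unfolding is_fun_def by blast
qed

lemma kpair_mem_is_fun:
  assumes "is_fun f x y" "a \<in> elts x"
  shows "kpair a b \<in> elts f \<longleftrightarrow> b = ap f a"
proof -
  obtain c where c: "kpair a c \<in> elts f"
    using assms unfolding is_fun_def by blast
  then have "ap f a = c"
    unfolding ap_def using is_fun_unique[OF assms(1)] by blast
  then show ?thesis
    using c is_fun_unique[OF assms(1)] by blast
qed

lemma ap_in:
  assumes "is_fun f x y" "a \<in> elts x"
  shows "ap f a \<in> elts y"
proof -
  obtain b where "b \<in> elts y" "kpair a b \<in> elts f"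
    using assms unfolding is_fun_def by blast
  then show ?thesis
    using kpair_mem_is_fun[OF assms] by simp
qed

text \<open>Brings a function into the form in which closure under sequences speaks of it.\<close>

lemma is_fun_eq_lam:
  assumes "is_fun f x y"
  shows "f = lam x (ap f)"
proof (rule extensionality)
  have "\<exists>a\<in>elts x. p = kpair a b \<and> b = ap f a" if "p \<in> elts f" and "p = kpair a b" for p a b
    using that assms kpair_mem_is_fun[OF assms, of a b] unfolding is_fun_def
    by (auto simp: kpair_inject)
  moreover have "\<exists>a b. p = kpair a b" if "p \<in> elts f" for p
    using that assms unfolding is_fun_def by blast
  ultimately have "p \<in> elts f \<longleftrightarrow> (\<exists>a\<in>elts x. p = kpair a (ap f a))" for p
    using kpair_mem_is_fun[OF assms] by fastforce
  then show "elts f = elts (lam x (ap f))"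
    by (auto simp: elts_lam)
qed

definition funspace :: "'v::zfc_universe \<Rightarrow> 'v \<Rightarrow> 'v" where
  "funspace x y = mkset {f. is_fun f x y}"

lemma elts_funspace: "elts (funspace x y) = {f. is_fun f x y}"
proof -
  obtain w where w: "elts w = {z. elts z \<subseteq> elts (cart x y)}"
    using is_setE[OF power_set[of "cart x y"]] by blast
  have "{f. is_fun f x y} \<subseteq> elts w"
    unfolding w is_fun_def elts_cart by fast
  then show ?thesis
    unfolding funspace_def by (intro elts_mkset is_set_subset)
qed

section \<open>Finite tuples coded as sets\<close>

primrec tuple_code :: "'v::zfc_universe list \<Rightarrow> 'v" where
  "tuple_code [] = mkset {}"
| "tuple_code (x # xs) = kpair x (tuple_code xs)"

text \<open>The length is a natural number of the metatheory, so an induction outside the universe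
  carries \<open>j\<close> through tuples and powers.\<close>

primrec tuple_set :: "'v::zfc_universe \<Rightarrow> nat \<Rightarrow> 'v" where
  "tuple_set u 0 = mkset {mkset {}}"
| "tuple_set u (Suc n) = cart u (tuple_set u n)"

lemma elts_tuple_set:
  "elts (tuple_set u n) = tuple_code ` {xs. length xs = n \<and> set xs \<subseteq> elts u}"
proof (induction n)
  case 0
  have "{xs :: 'a list. xs = [] \<and> set xs \<subseteq> elts u} = {[]}"
    by auto
  then show ?case by (simp add: elts_mkset is_set_singleton)
next
  case (Suc n)
  show ?case
  proof (rule set_eqI, rule iffI)
    fix c assume "c \<in> elts (tuple_set u (Suc n))"
    then obtain a xs where "c = kpair a (tuple_code xs)" "a \<in> elts u" "length xs = n"
      "set xs \<subseteq> elts u"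
      by (auto simp: elts_cart Suc)
    then show "c \<in> tuple_code ` {xs. length xs = Suc n \<and> set xs \<subseteq> elts u}"
      by (intro image_eqI[of _ _ "a # xs"]) auto
  next
    fix c assume "c \<in> tuple_code ` {xs. length xs = Suc n \<and> set xs \<subseteq> elts u}"
    then obtain a xs where "c = kpair a (tuple_code xs)" "a \<in> elts u" "length xs = n"
      "set xs \<subseteq> elts u"
      by (auto simp: length_Suc_conv)
    then show "c \<in> elts (tuple_set u (Suc n))"
      by (auto simp: elts_cart Suc)
  qed
qed

lemma tuple_code_inject:
  "length xs = length ys \<Longrightarrow> tuple_code xs = tuple_code ys \<longleftrightarrow> xs = ys"
  by (induction xs ys rule: list_induct2) (auto simp: kpair_inject)

section \<open>Ordinals\<close>

lemma Ordinal_in: "Ordinal \<beta> \<Longrightarrow> \<alpha> \<in> elts \<beta> \<Longrightarrow> Ordinal \<alpha>"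
  unfolding Ordinal_def transitive_set_def by blast

lemma Ordinal_trans: "Ordinal \<gamma> \<Longrightarrow> \<alpha> \<in> elts \<beta> \<Longrightarrow> \<beta> \<in> elts \<gamma> \<Longrightarrow> \<alpha> \<in> elts \<gamma>"
  unfolding Ordinal_def transitive_set_def by blast

lemma Ordinal_subset: "Ordinal \<beta> \<Longrightarrow> \<alpha> \<in> elts \<beta> \<Longrightarrow> elts \<alpha> \<subseteq> elts \<beta>"
  unfolding Ordinal_def transitive_set_def by blast

lemma ord_le_subset: "Ordinal \<beta> \<Longrightarrow> ord_le \<alpha> \<beta> \<Longrightarrow> elts \<alpha> \<subseteq> elts \<beta>"
  unfolding ord_le_def using Ordinal_subset by blast

lemma Ordinal_mem_ord_le: "Ordinal \<gamma> \<Longrightarrow> \<alpha> \<in> elts \<beta> \<Longrightarrow> ord_le \<beta> \<gamma> \<Longrightarrow> \<alpha> \<in> elts \<gamma>"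
  unfolding ord_le_def using Ordinal_trans by blast

lemma ord_le_mem: "Ordinal \<gamma> \<Longrightarrow> ord_le \<alpha> \<beta> \<Longrightarrow> \<beta> \<in> elts \<gamma> \<Longrightarrow> \<alpha> \<in> elts \<gamma>"
  unfolding ord_le_def using Ordinal_trans by blast

text \<open>Nested induction: if the two are incomparable, the hypotheses for their elements put
  each inside the other, and extensionality makes them equal.\<close>

lemma Ordinal_linear:
  fixes \<alpha> \<beta> :: "'v::zfc_universe"
  assumes "Ordinal \<alpha>" "Ordinal \<beta>"
  shows "\<alpha> \<in> elts \<beta> \<or> \<alpha> = \<beta> \<or> \<beta> \<in> elts \<alpha>"
  using assms
proof (induction \<alpha> arbitrary: \<beta> rule: wf_induct_rule[OF foundation])
  case (1 \<alpha>)
  note outer = 1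
  from \<open>Ordinal \<beta>\<close> show ?case
  proof (induction \<beta> rule: wf_induct_rule[OF foundation])
    case (1 \<beta>)
    show ?case
    proof (rule ccontr)
      assume no: "\<not> ?case"
      have "x \<in> elts \<beta>" if "x \<in> elts \<alpha>" for x
        using outer(1)[of x \<beta>] that no outer(2) 1(2) Ordinal_in[of \<alpha> x]
          Ordinal_trans[of \<alpha> \<beta> x] by auto
      moreover have "x \<in> elts \<alpha>" if "x \<in> elts \<beta>" for x
        using 1(1)[of x] that no outer(2) 1(2) Ordinal_in[of \<beta> x]
          Ordinal_trans[of \<beta> \<alpha> x] by auto
      ultimately have "\<alpha> = \<beta>"
        by (intro extensionality) blast
      with no show False by simp
    qed
  qed
qed

lemma Cardinal_Ordinal: "Cardinal \<kappa> \<Longrightarrow> Ordinal \<kappa>"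
  unfolding Cardinal_def by simp

lemma mem_minimalE:
  fixes x :: "'v::zfc_universe"
  assumes "x \<in> Q"
  obtains z where "z \<in> Q" "\<And>y. y \<in> elts z \<Longrightarrow> y \<notin> Q"
  by (rule wfE_min[OF foundation assms]) (simp add: that)

text \<open>Foundation gives a minimal ordinal up to \<open>\<beta>\<close> of the same size;
  minimality is what makes it a cardinal.\<close>

lemma ex_Cardinal_eqpoll:
  fixes \<beta> :: "'v::zfc_universe"
  assumes "Ordinal \<beta>"
  obtains \<kappa> where "Cardinal \<kappa>" "ord_le \<kappa> \<beta>" "elts \<kappa> \<approx> elts \<beta>"
proof -
  let ?Q = "{\<alpha>. ord_le \<alpha> \<beta> \<and> elts \<alpha> \<approx> elts \<beta>}"
  have "\<beta> \<in> ?Q" by (simp add: ord_le_def)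
  then obtain \<kappa> where \<kappa>: "\<kappa> \<in> ?Q" and min: "\<And>\<alpha>. \<alpha> \<in> elts \<kappa> \<Longrightarrow> \<alpha> \<notin> ?Q"
    by (rule mem_minimalE) blast
  have ord: "Ordinal \<kappa>"
    using \<kappa> assms Ordinal_in by (auto simp: ord_le_def)
  have "\<not> elts \<alpha> \<approx> elts \<kappa>" if "\<alpha> \<in> elts \<kappa>" for \<alpha>
    using min[OF that] \<kappa> Ordinal_mem_ord_le[OF assms that] eqpoll_trans[of "elts \<alpha>" "elts \<kappa>" "elts \<beta>"]
    by (auto simp: ord_le_def)
  with \<kappa> ord show thesis
    by (intro that) (auto simp: Cardinal_def)
qed

section \<open>Sizes below a cardinal, and regular cardinals\<close>

lemma Cardinal_lesspoll: "Cardinal \<kappa> \<Longrightarrow> \<alpha> \<in> elts \<kappa> \<Longrightarrow> elts \<alpha> \<prec> elts \<kappa>"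
  unfolding Cardinal_def lesspoll_def
  by (meson Ordinal_subset lepoll_iff_leqpoll subset_imp_lepoll)

text \<open>Regularity is defined for subsets of \<open>\<eta>\<close>; an injection of
  \<open>X\<close> into \<open>\<eta>\<close> carries it over to arbitrary small sets.\<close>

lemma regular_bound:
  assumes "regular_cardinal \<eta>" "X \<prec> elts \<eta>"
  obtains \<beta> where "\<beta> \<in> elts \<eta>" "X \<lesssim> elts \<beta>"
proof -
  obtain g where g: "inj_on g X" "g ` X \<subseteq> elts \<eta>"
    using lesspoll_imp_lepoll[OF assms(2)] by (auto simp: lepoll_def)
  have "g ` X \<prec> elts \<eta>"
    using assms(2) image_lepoll lesspoll_trans1 by blast
  with g(2) assms(1) obtain \<beta> where "\<beta> \<in> elts \<eta>" "g ` X \<subseteq> elts \<beta>"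
    unfolding regular_cardinal_def by blast
  with g(1) show thesis
    by (intro that) (auto simp: lepoll_def)
qed

lemma regular_bound_family:
  assumes "regular_cardinal \<eta>" "I \<prec> elts \<eta>" "\<And>i. i \<in> I \<Longrightarrow> g i \<in> elts \<eta>"
  obtains \<beta> where "\<beta> \<in> elts \<eta>" "\<And>i. i \<in> I \<Longrightarrow> g i \<in> elts \<beta>"
proof -
  have "g ` I \<prec> elts \<eta>" "g ` I \<subseteq> elts \<eta>"
    using assms image_lepoll lesspoll_trans1 by blast+
  with assms(1) obtain \<beta> where "\<beta> \<in> elts \<eta>" "g ` I \<subseteq> elts \<beta>"
    unfolding regular_cardinal_def by blast
  then show thesis by (intro that) auto
qed

text \<open>Regularity applied to a two-element set. The bound is strict, so with equal arguments
  this says that \<open>\<eta>\<close> is a limit.\<close>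

lemma regular_max:
  assumes "regular_cardinal \<eta>" "\<beta>1 \<in> elts \<eta>" "\<beta>2 \<in> elts \<eta>"
  obtains \<beta> where "\<beta> \<in> elts \<eta>" "\<beta>1 \<in> elts \<beta>" "\<beta>2 \<in> elts \<beta>"
proof -
  have "{\<beta>1, \<beta>2} \<prec> elts \<eta>"
    using assms(1) by (intro finite_lesspoll_infinite) (auto simp: regular_cardinal_def)
  then show thesis
    using regular_bound_family[OF assms(1), of "{\<beta>1, \<beta>2}" "\<lambda>x. x"] assms(2,3) that
    by (metis insertCI insertE singletonD)
qed

lemma lepoll_finite: "A \<lesssim> B \<Longrightarrow> finite B \<Longrightarrow> finite A"
  unfolding lepoll_def by (metis finite_imageD finite_subset)

lemma UN_lepoll_infinite:
  assumes "infinite B" "I \<lesssim> B" "\<And>i. i \<in> I \<Longrightarrow> A i \<lesssim> B"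
  shows "(\<Union>i\<in>I. A i) \<lesssim> B"
  using assms card_of_UNION_ordLeq_infinite[of B I A]
  by (simp add: lepoll_def card_of_ordLeq)

text \<open>One \<open>\<beta>\<close> below \<open>\<eta>\<close> bounds both the index set and all
  the members, so the union is no larger than \<open>\<beta>\<close> if \<open>\<beta>\<close> is
  infinite.\<close>

lemma regular_UN_lesspoll:
  fixes \<eta> :: "'v::zfc_universe"
  assumes \<eta>: "regular_cardinal \<eta>" and I: "I \<prec> elts \<eta>" and A: "\<And>i. i \<in> I \<Longrightarrow> A i \<prec> elts \<eta>"
  shows "(\<Union>i\<in>I. A i) \<prec> elts \<eta>"
proof -
  have card: "Cardinal \<eta>" and inf: "infinite (elts \<eta>)"
    using \<eta> by (auto simp: regular_cardinal_def)
  note ord = Cardinal_Ordinal[OF card]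
  have "\<forall>i\<in>I. \<exists>\<beta>. \<beta> \<in> elts \<eta> \<and> A i \<lesssim> elts \<beta>"
    using regular_bound[OF \<eta> A] by metis
  then obtain g where g: "\<And>i. i \<in> I \<Longrightarrow> g i \<in> elts \<eta> \<and> A i \<lesssim> elts (g i)"
    by metis
  obtain \<beta>1 where \<beta>1: "\<beta>1 \<in> elts \<eta>" "\<And>i. i \<in> I \<Longrightarrow> g i \<in> elts \<beta>1"
    using regular_bound_family[OF \<eta> I] g by metis
  obtain \<beta>2 where \<beta>2: "\<beta>2 \<in> elts \<eta>" "I \<lesssim> elts \<beta>2"
    using regular_bound[OF \<eta> I] by metis
  obtain \<beta> where \<beta>: "\<beta> \<in> elts \<eta>" "\<beta>1 \<in> elts \<beta>" "\<beta>2 \<in> elts \<beta>"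
    using regular_max[OF \<eta> \<beta>1(1) \<beta>2(1)] by metis
  have ord\<beta>: "Ordinal \<beta>"
    using ord \<beta>(1) by (rule Ordinal_in)
  have Ib: "I \<lesssim> elts \<beta>"
    using \<beta>2(2) Ordinal_subset[OF ord\<beta> \<beta>(3)] lepoll_trans subset_imp_lepoll by blast
  have Ab: "A i \<lesssim> elts \<beta>" if "i \<in> I" for i
    using g[OF that] \<beta>1(2)[OF that] \<beta>(2) ord\<beta>
    by (metis Ordinal_subset Ordinal_trans lepoll_trans subset_imp_lepoll)
  show ?thesis
  \<comment> \<open>A union of at most \<open>\<beta>\<close> sets of size at most
    \<open>\<beta>\<close> can exceed a finite \<open>\<beta>\<close>, but then it is finite and
    \<open>\<eta>\<close> is infinite.\<close>
  proof (cases "finite (elts \<beta>)")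
    case True
    then have "finite I" "\<And>i. i \<in> I \<Longrightarrow> finite (A i)"
      using Ib Ab lepoll_finite by blast+
    then show ?thesis
      by (intro finite_lesspoll_infinite[OF inf] finite_UN_I)
  next
    case False
    then show ?thesis
      by (intro lesspoll_trans1[OF UN_lepoll_infinite[OF _ Ib Ab] Cardinal_lesspoll[OF card \<beta>(1)]])
  qed
qed

section \<open>Definable predicates\<close>

primrec set_fm_vars :: "set_fm \<Rightarrow> nat set" where
  "set_fm_vars (SMem m n) = {m, n}"
| "set_fm_vars (SEq m n) = {m, n}"
| "set_fm_vars (SNeg \<phi>) = set_fm_vars \<phi>"
| "set_fm_vars (SConj \<phi> \<psi>) = set_fm_vars \<phi> \<union> set_fm_vars \<psi>"
| "set_fm_vars (SEx n \<phi>) = insert n (set_fm_vars \<phi>)"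

primrec rename_fm :: "(nat \<Rightarrow> nat) \<Rightarrow> set_fm \<Rightarrow> set_fm" where
  "rename_fm \<rho> (SMem m n) = SMem (\<rho> m) (\<rho> n)"
| "rename_fm \<rho> (SEq m n) = SEq (\<rho> m) (\<rho> n)"
| "rename_fm \<rho> (SNeg \<phi>) = SNeg (rename_fm \<rho> \<phi>)"
| "rename_fm \<rho> (SConj \<phi> \<psi>) = SConj (rename_fm \<rho> \<phi>) (rename_fm \<rho> \<psi>)"
| "rename_fm \<rho> (SEx n \<phi>) = SEx (\<rho> n) (rename_fm \<rho> \<phi>)"

lemma finite_set_fm_vars: "finite (set_fm_vars \<phi>)"
  by (induction \<phi>) auto

text \<open>Bound variables are counted in \<open>set_fm_vars\<close> and renamed too, so
  injectivity there rules out capture.\<close>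

lemma set_sat_rename:
  assumes "inj_on \<rho> (set_fm_vars \<phi>)" "\<And>i. i \<in> set_fm_vars \<phi> \<Longrightarrow> s' i = s (\<rho> i)"
  shows "set_sat M s (rename_fm \<rho> \<phi>) \<longleftrightarrow> set_sat M s' \<phi>"
  using assms
proof (induction \<phi> arbitrary: s s')
  case (SConj \<phi> \<psi>)
  have "set_sat M s (rename_fm \<rho> \<phi>) \<longleftrightarrow> set_sat M s' \<phi>"
    "set_sat M s (rename_fm \<rho> \<psi>) \<longleftrightarrow> set_sat M s' \<psi>"
    using SConj.prems by (auto intro!: SConj.IH simp: inj_on_def)
  then show ?case by simp
next
  case (SEx n \<phi>)
  have "set_sat M (s(\<rho> n := x)) (rename_fm \<rho> \<phi>) \<longleftrightarrow> set_sat M (s'(n := x)) \<phi>" for x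
    using SEx.prems by (intro SEx.IH) (auto simp: inj_on_def)
  then show ?case by simp
next
  case (SNeg \<phi>)
  have "set_sat M s (rename_fm \<rho> \<phi>) \<longleftrightarrow> set_sat M s' \<phi>"
    using SNeg.prems by (intro SNeg.IH) simp_all
  then show ?case by simp
qed auto

text \<open>The predicate takes the class \<open>M\<close> as an argument, so that unbounded
  quantifiers can range over it. Only transitive classes are considered, which makes bounded
  quantifiers absolute.\<close>

definition definable :: "('v::zfc_universe set \<Rightarrow> (nat \<Rightarrow> 'v) \<Rightarrow> bool) \<Rightarrow> bool" where
  "definable P \<longleftrightarrow> (\<exists>\<phi>. \<forall>M s. transitive_class M \<longrightarrow> range s \<subseteq> M \<longrightarrow> set_sat M s \<phi> = P M s)"

lemma definable_cong:
  assumes "definable P" "\<And>M s. transitive_class M \<Longrightarrow> range s \<subseteq> M \<Longrightarrow> P M s \<longleftrightarrow> Q M s"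
  shows "definable Q"
  using assms unfolding definable_def by metis

lemma definable_mem: "definable (\<lambda>M s. s m \<in> elts (s n))"
  unfolding definable_def by (metis set_sat.simps(1))

lemma definable_eq: "definable (\<lambda>M s. s m = s n)"
  unfolding definable_def by (metis set_sat.simps(2))

lemma definable_not: "definable P \<Longrightarrow> definable (\<lambda>M s. \<not> P M s)"
  unfolding definable_def by (metis set_sat.simps(3))

lemma definable_conj: "definable P \<Longrightarrow> definable Q \<Longrightarrow> definable (\<lambda>M s. P M s \<and> Q M s)"
  unfolding definable_def by (metis set_sat.simps(4))

lemma definable_disj: "definable P \<Longrightarrow> definable Q \<Longrightarrow> definable (\<lambda>M s. P M s \<or> Q M s)"
  by (rule definable_cong[OF definable_not[OF definable_conj[OF definable_not definable_not]]]) auto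

lemma definable_imp: "definable P \<Longrightarrow> definable Q \<Longrightarrow> definable (\<lambda>M s. P M s \<longrightarrow> Q M s)"
  by (rule definable_cong[OF definable_disj[OF definable_not[of P], of Q]]) auto

lemma definable_iff: "definable P \<Longrightarrow> definable Q \<Longrightarrow> definable (\<lambda>M s. P M s \<longleftrightarrow> Q M s)"
  by (rule definable_cong[OF definable_conj[OF definable_imp[of P Q] definable_imp[of Q P]]]) auto

text \<open>
  The quantified variable becomes number 0 and the others are shifted, so that
  definability can be checked syntactically, without freshness conditions.
\<close>

lemma definable_ex:
  assumes "definable (\<lambda>M s. Q (s 0) M (\<lambda>i. s (Suc i)))"
  shows "definable (\<lambda>M s. \<exists>x\<in>M. Q x M s)"
proof -
  obtain \<phi> where \<phi>: "\<And>M s. transitive_class M \<Longrightarrow> range s \<subseteq> M \<Longrightarrow>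
      set_sat M s \<phi> = Q (s 0) M (\<lambda>i. s (Suc i))"
    using assms unfolding definable_def by blast
  obtain N where N: "\<And>i. i \<in> set_fm_vars \<phi> \<Longrightarrow> i < N"
    using finite_set_fm_vars[of \<phi>] finite_nat_set_iff_bounded by metis
  \<comment> \<open>\<open>\<rho>\<close> undoes the shift: variable 0 becomes the fresh
    \<open>N\<close>, and \<open>Suc i\<close> becomes \<open>i\<close>, which lies below
    \<open>N\<close>.\<close>
  define \<rho> where "\<rho> = case_nat N (\<lambda>i. i)"
  have inj: "inj_on \<rho> (set_fm_vars \<phi>)"
    using N by (force simp: inj_on_def \<rho>_def split: nat.splits)
  have "set_sat M s (SEx N (rename_fm \<rho> \<phi>)) \<longleftrightarrow> (\<exists>x\<in>M. Q x M s)"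
    if "transitive_class M" "range s \<subseteq> M" for M s
  proof -
    have "set_sat M (s(N := x)) (rename_fm \<rho> \<phi>) \<longleftrightarrow> Q x M s" if x: "x \<in> M" for x
    proof -
      have "set_sat M (s(N := x)) (rename_fm \<rho> \<phi>) \<longleftrightarrow> set_sat M (case_nat x s) \<phi>"
      proof (rule set_sat_rename[OF inj])
        fix i assume "i \<in> set_fm_vars \<phi>"
        then show "case_nat x s i = (s(N := x)) (\<rho> i)"
          using N[of i] by (auto simp: \<rho>_def split: nat.splits)
      qed
      also have "\<dots> \<longleftrightarrow> Q x M s"
        using \<phi>[of M "case_nat x s"] \<open>transitive_class M\<close> \<open>range s \<subseteq> M\<close> x
        by (simp add: image_subset_iff split: nat.split)
      finally show ?thesis .
    qed
    then show ?thesis by simp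
  qed
  then show ?thesis
    unfolding definable_def by blast
qed

lemma definable_all:
  assumes "definable (\<lambda>M s. Q (s 0) M (\<lambda>i. s (Suc i)))"
  shows "definable (\<lambda>M s. \<forall>x\<in>M. Q x M s)"
  by (rule definable_cong[OF definable_not[OF definable_ex[where Q = "\<lambda>x M s. \<not> Q x M s"]]])
     (auto intro: definable_not assms)

text \<open>In a transitive class all elements of \<open>s m\<close> lie in \<open>M\<close>, so the
  quantifier can be relativised to \<open>M\<close>.\<close>

lemma definable_bex:
  assumes "definable (\<lambda>M s. Q (s 0) M (\<lambda>i. s (Suc i)))"
  shows "definable (\<lambda>M s. \<exists>x\<in>elts (s m). Q x M s)"
proof (rule definable_cong)
  show "definable (\<lambda>M s. \<exists>x\<in>M. x \<in> elts (s m) \<and> Q x M s)"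
    by (intro definable_ex definable_conj definable_mem assms)
next
  fix M :: "'a set" and s :: "nat \<Rightarrow> 'a"
  assume "transitive_class M" "range s \<subseteq> M"
  then have "elts (s m) \<subseteq> M"
    by (auto simp: transitive_class_def)
  then show "(\<exists>x\<in>M. x \<in> elts (s m) \<and> Q x M s) \<longleftrightarrow> (\<exists>x\<in>elts (s m). Q x M s)"
    by blast
qed

lemma definable_ball:
  assumes "definable (\<lambda>M s. Q (s 0) M (\<lambda>i. s (Suc i)))"
  shows "definable (\<lambda>M s. \<forall>x\<in>elts (s m). Q x M s)"
  by (rule definable_cong[OF definable_not[OF definable_bex[where Q = "\<lambda>x M s. \<not> Q x M s"]]])
     (auto intro: definable_not assms)

lemmas definable_logic = definable_mem definable_eq definable_not definable_conj definable_disj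
  definable_imp definable_iff definable_ex definable_all definable_bex definable_ball

text \<open>Spells out the Kuratowski pair with quantifiers bounded by \<open>p\<close> and its
  elements; \<open>a\<close> is {x} and \<open>b\<close> is {x, y}.\<close>

lemma eq_kpair_iff:
  "p = kpair x y \<longleftrightarrow> (\<exists>a\<in>elts p. \<exists>b\<in>elts p. (\<forall>z\<in>elts p. z = a \<or> z = b) \<and>
     (x \<in> elts a \<and> (\<forall>w\<in>elts a. w = x)) \<and>
     (x \<in> elts b \<and> y \<in> elts b \<and> (\<forall>w\<in>elts b. w = x \<or> w = y)))" (is "_ \<longleftrightarrow> ?R")
proof
  assume "p = kpair x y"
  then show ?R
    by (intro bexI[of _ "mkset {x}"] bexI[of _ "mkset {x, y}"])
       (auto simp: elts_kpair elts_mkset is_set_singleton elts_mkset_doubleton)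
next
  assume ?R
  then obtain a b where *: "a \<in> elts p" "b \<in> elts p" "\<forall>z\<in>elts p. z = a \<or> z = b"
    "x \<in> elts a \<and> (\<forall>w\<in>elts a. w = x)" "x \<in> elts b \<and> y \<in> elts b \<and> (\<forall>w\<in>elts b. w = x \<or> w = y)"
    by blast
  then have "elts a = elts (mkset {x})" "elts b = elts (mkset {x, y})" and p: "elts p = {a, b}"
    unfolding elts_mkset_doubleton elts_mkset[OF is_set_singleton] by blast+
  then have "a = mkset {x}" "b = mkset {x, y}"
    by (simp_all add: extensionality)
  with p show "p = kpair x y"
    by (intro extensionality) (simp add: elts_kpair)
qed

lemma definable_eq_kpair: "definable (\<lambda>M s. s i = kpair (s k) (s n))"
  unfolding eq_kpair_iff by (intro definable_logic)

lemma definable_kpair_mem: "definable (\<lambda>M s. kpair (s k) (s n) \<in> elts (s i))"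
proof -
  have "definable (\<lambda>M s. \<exists>p\<in>elts (s i). p = kpair (s k) (s n))"
    by (intro definable_logic definable_eq_kpair)
  then show ?thesis by simp
qed

lemma definable_is_fun: "definable (\<lambda>M s. is_fun (s i) (s k) (s n))"
  unfolding is_fun_def by (intro definable_logic definable_eq_kpair definable_kpair_mem)

lemmas definable_intros = definable_logic definable_eq_kpair definable_kpair_mem definable_is_fun

section \<open>Elementary embeddings\<close>

locale elementary =
  fixes j :: "'v::zfc_universe \<Rightarrow> 'v" and M :: "'v set"
  assumes transitive: "transitive_class M" and elementary: "elementary_embedding j M"
begin

lemma j_in_M: "j x \<in> M"
  using elementary by (auto simp: elementary_embedding_def)

lemma mem_j_in_M: "x \<in> elts (j y) \<Longrightarrow> x \<in> M"
  using j_in_M transitive by (auto simp: transitive_class_def)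

text \<open>Elementarity for semantic predicates: \<open>UNIV\<close> is itself a transitive class,
  so the same formula defines \<open>P\<close> on both sides.\<close>

lemma transfer:
  assumes "definable P"
  shows "P UNIV s \<longleftrightarrow> P M (j \<circ> s)"
proof -
  obtain \<phi> where \<phi>: "\<And>M s. transitive_class M \<Longrightarrow> range s \<subseteq> M \<Longrightarrow> set_sat M s \<phi> = P M s"
    using assms unfolding definable_def by blast
  have "P UNIV s \<longleftrightarrow> set_sat UNIV s \<phi>"
    by (subst \<phi>) (auto simp: transitive_class_def)
  also have "\<dots> \<longleftrightarrow> set_sat M (j \<circ> s) \<phi>"
    using elementary by (simp add: elementary_embedding_def)
  also have "\<dots> \<longleftrightarrow> P M (j \<circ> s)"
    using transitive j_in_M by (intro \<phi>) auto
  finally show ?thesis .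
qed

text \<open>The assignment \<open>(!) [a, b, c]\<close> passes the parameters as variables 0, 1, 2,
  so each use only has to name its property as \<open>R\<close>.\<close>

lemma transfer3:
  assumes "definable (\<lambda>M s. R M (s 0) (s 1) (s 2))"
  shows "R UNIV a b c \<longleftrightarrow> R M (j a) (j b) (j c)"
  using transfer[OF assms, of "(!) [a, b, c]"] by simp

lemma transfer6:
  assumes "definable (\<lambda>M s. R M (s 0) (s 1) (s 2) (s 3) (s 4) (s 5))"
  shows "R UNIV a b c d e f \<longleftrightarrow> R M (j a) (j b) (j c) (j d) (j e) (j f)"
  using transfer[OF assms, of "(!) [a, b, c, d, e, f]"]
  by (simp add: numeral_eq_Suc)

section \<open>Images of pairs, products and tuples under the embedding\<close>

lemma j_eq_iff: "j x = j y \<longleftrightarrow> x = y"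
  by (rule transfer3[where R = "\<lambda>M a b c. a = b", symmetric]) (intro definable_intros)

lemma j_mem_iff: "j x \<in> elts (j y) \<longleftrightarrow> x \<in> elts y"
  by (rule transfer3[where R = "\<lambda>M a b c. a \<in> elts b", symmetric]) (intro definable_intros)

lemma j_kpair: "j (kpair x y) = kpair (j x) (j y)"
  using transfer3[where R = "\<lambda>M a b c. a = kpair b c", of "kpair x y" x y]
  by (auto intro!: definable_intros)

lemma j_empty: "j (mkset {}) = mkset {}"
proof -
  have "(\<forall>z\<in>elts (mkset {} :: 'v). z \<noteq> z) \<longleftrightarrow> (\<forall>z\<in>elts (j (mkset {})). z \<noteq> z)"
    by (rule transfer3[where R = "\<lambda>M a b c. \<forall>z\<in>elts a. z \<noteq> z"]) (intro definable_intros)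
  then show ?thesis
    by (intro extensionality) (simp add: elts_mkset is_set_empty)
qed

lemma j_is_fun_iff: "is_fun (j f) (j x) (j y) \<longleftrightarrow> is_fun f x y"
  by (rule transfer3[where R = "\<lambda>M a b c. is_fun a b c", symmetric]) (intro definable_intros)

lemma j_ap:
  assumes "is_fun f x y" "a \<in> elts x"
  shows "j (ap f a) = ap (j f) (j a)"
proof -
  have "kpair a (ap f a) \<in> elts f"
    using kpair_mem_is_fun[OF assms] by simp
  then have "kpair (j a) (j (ap f a)) \<in> elts (j f)"
    by (simp add: j_mem_iff flip: j_kpair)
  moreover have "is_fun (j f) (j x) (j y)" "j a \<in> elts (j x)"
    using assms by (simp_all add: j_is_fun_iff j_mem_iff)
  ultimately show ?thesis
    by (simp add: kpair_mem_is_fun)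
qed

lemma j_cart: "j (cart x y) = cart (j x) (j y)"
proof -
  have "(\<forall>p\<in>UNIV. p \<in> elts (cart x y) \<longleftrightarrow> (\<exists>a\<in>elts x. \<exists>b\<in>elts y. p = kpair a b)) \<longleftrightarrow>
      (\<forall>p\<in>M. p \<in> elts (j (cart x y)) \<longleftrightarrow> (\<exists>a\<in>elts (j x). \<exists>b\<in>elts (j y). p = kpair a b))"
    by (rule transfer3[where R = "\<lambda>M c x y. \<forall>p\<in>M. p \<in> elts c \<longleftrightarrow>
        (\<exists>a\<in>elts x. \<exists>b\<in>elts y. p = kpair a b)"]) (intro definable_intros)
  then have *: "\<forall>p\<in>M. p \<in> elts (j (cart x y)) \<longleftrightarrow> p \<in> elts (cart (j x) (j y))"
    by (auto simp: elts_cart image_iff)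
  show ?thesis
  proof (rule extensionality, rule set_eqI)
    fix p
    show "p \<in> elts (j (cart x y)) \<longleftrightarrow> p \<in> elts (cart (j x) (j y))"
    proof
      assume "p \<in> elts (j (cart x y))"
      then show "p \<in> elts (cart (j x) (j y))"
        using * mem_j_in_M by blast
    next
      assume p: "p \<in> elts (cart (j x) (j y))"
      \<comment> \<open>The first transfer decides only those \<open>p\<close> that lie in
        \<open>M\<close>. This bounded formula yields that the pairs belong to
        \<open>j (cart x y)\<close>, and hence to \<open>M\<close>.\<close>
      have "(\<forall>a\<in>elts x. \<forall>b\<in>elts y. kpair a b \<in> elts (cart x y)) \<longleftrightarrow>
          (\<forall>a\<in>elts (j x). \<forall>b\<in>elts (j y). kpair a b \<in> elts (j (cart x y)))"
        by (rule transfer3[where R = "\<lambda>M c x y. \<forall>a\<in>elts x. \<forall>b\<in>elts y. kpair a b \<in> elts c"])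
           (intro definable_intros)
      with p show "p \<in> elts (j (cart x y))"
        by (auto simp: elts_cart)
    qed
  qed
qed

lemma j_singleton: "j (mkset {x}) = mkset {j x}"
proof -
  have "(x \<in> elts (mkset {x}) \<and> (\<forall>z\<in>elts (mkset {x}). z = x)) \<longleftrightarrow>
      (j x \<in> elts (j (mkset {x})) \<and> (\<forall>z\<in>elts (j (mkset {x})). z = j x))"
    by (rule transfer3[where R = "\<lambda>M a b c. b \<in> elts a \<and> (\<forall>z\<in>elts a. z = b)"])
       (intro definable_intros)
  then show ?thesis
    by (intro extensionality) (auto simp: elts_mkset is_set_singleton)
qed

lemma j_tuple_code: "j (tuple_code xs) = tuple_code (map j xs)"
  by (induction xs) (simp_all add: j_kpair j_empty)

lemma j_tuple_set: "j (tuple_set u n) = tuple_set (j u) n"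
  by (induction n) (simp_all add: j_cart j_singleton j_empty)

lemma j_transitive_set:
  assumes "transitive_set x"
  shows "transitive_set (j x)"
proof -
  have "(\<forall>y\<in>elts x. \<forall>z\<in>elts y. z \<in> elts x) \<longleftrightarrow> (\<forall>y\<in>elts (j x). \<forall>z\<in>elts y. z \<in> elts (j x))"
    by (rule transfer3[where R = "\<lambda>M a b c. \<forall>y\<in>elts a. \<forall>z\<in>elts y. z \<in> elts a"])
       (intro definable_intros)
  with assms show ?thesis
    by (auto simp: transitive_set_def)
qed

text \<open>The graph of an injection is sent to the graph of an injection, because injectivity is a
  bounded property of the graph.\<close>

lemma lepoll_j:
  assumes "elts x \<lesssim> elts y"
  shows "elts (j x) \<lesssim> elts (j y)"
proof -
  obtain g where g: "inj_on g (elts x)" "g ` elts x \<subseteq> elts y"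
    using assms by (auto simp: lepoll_def)
  let ?e = "lam x g"
  have e: "is_fun ?e x y"
    using g(2) by (simp add: is_fun_lam)
  have "(\<forall>a\<in>elts x. \<forall>b\<in>elts x. \<forall>c\<in>elts y. kpair a c \<in> elts ?e \<longrightarrow> kpair b c \<in> elts ?e \<longrightarrow> a = b) \<longleftrightarrow>
      (\<forall>a\<in>elts (j x). \<forall>b\<in>elts (j x). \<forall>c\<in>elts (j y).
        kpair a c \<in> elts (j ?e) \<longrightarrow> kpair b c \<in> elts (j ?e) \<longrightarrow> a = b)"
    by (rule transfer3[where R = "\<lambda>M x y e. \<forall>a\<in>elts x. \<forall>b\<in>elts x. \<forall>c\<in>elts y.
        kpair a c \<in> elts e \<longrightarrow> kpair b c \<in> elts e \<longrightarrow> a = b"]) (intro definable_intros)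
  moreover have "\<forall>a\<in>elts x. \<forall>b\<in>elts x. \<forall>c\<in>elts y.
      kpair a c \<in> elts ?e \<longrightarrow> kpair b c \<in> elts ?e \<longrightarrow> a = b"
    using inj_onD[OF g(1)] by (fastforce simp: elts_lam kpair_inject)
  ultimately have inj: "\<forall>a\<in>elts (j x). \<forall>b\<in>elts (j x). \<forall>c\<in>elts (j y).
        kpair a c \<in> elts (j ?e) \<longrightarrow> kpair b c \<in> elts (j ?e) \<longrightarrow> a = b"
    by blast
  have je: "is_fun (j ?e) (j x) (j y)"
    using e by (simp add: j_is_fun_iff)
  have "inj_on (ap (j ?e)) (elts (j x))"
  proof (rule inj_onI)
    fix a b assume ab: "a \<in> elts (j x)" "b \<in> elts (j x)" "ap (j ?e) a = ap (j ?e) b"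
    then have "kpair a (ap (j ?e) a) \<in> elts (j ?e)" "kpair b (ap (j ?e) a) \<in> elts (j ?e)"
      by (simp_all add: kpair_mem_is_fun[OF je])
    then show "a = b"
      using inj ab ap_in[OF je] by blast
  qed
  then show ?thesis
    using ap_in[OF je] unfolding lepoll_def by blast
qed

end

section \<open>Embeddings closed under sequences of a length below the critical point\<close>

locale closed_elementary = elementary j M
  for j :: "'v::zfc_universe \<Rightarrow> 'v" and M :: "'v set" +
  fixes \<kappa> l :: 'v
  assumes crit: "critical_point j \<kappa>" and l_mem: "l \<in> elts \<kappa>"
    and closed: "closed_under_sequences M l"
begin

lemma j_l: "j l = l"
  using crit l_mem by (auto simp: critical_point_def)

lemma j_below: "\<alpha> \<in> elts l \<Longrightarrow> j \<alpha> = \<alpha>"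
  using crit l_mem Ordinal_trans by (auto simp: critical_point_def)

text \<open>An enumeration of \<open>z\<close> along \<open>l\<close> is sent to an enumeration of
  \<open>j z\<close> along \<open>j l = l\<close>. Since \<open>j\<close> fixes each index
  \<open>a\<close>, the entry at \<open>a\<close> is the image of the old entry.\<close>

lemma elts_j_small:
  assumes "elts z \<lesssim> elts l"
  shows "elts (j z) = j ` elts z"
proof (cases "elts z = {}")
  case True
  then have "z = mkset {}"
    by (intro extensionality) (simp add: elts_mkset is_set_empty)
  then show ?thesis
    by (simp add: j_empty elts_mkset is_set_empty)
next
  case False
  then obtain z0 where z0: "z0 \<in> elts z"
    by blast
  obtain g0 where g0: "elts z \<subseteq> g0 ` elts l"
    using assms by (auto simp: lepoll_iff)
  \<comment> \<open>\<open>g0\<close> covers \<open>z\<close> but may take values outside it; these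
    are redirected to \<open>z0\<close>.\<close>
  define g where "g = (\<lambda>a. if g0 a \<in> elts z then g0 a else z0)"
  have g: "g ` elts l = elts z"
    using g0 z0 by (fastforce simp: g_def image_iff)
  let ?e = "lam l g"
  have e: "is_fun ?e l z"
    using g by (simp add: is_fun_lam)
  have je: "is_fun (j ?e) l (j z)"
    using e j_is_fun_iff[of ?e l z] by (simp add: j_l)
  have "(\<forall>y\<in>elts z. \<exists>a\<in>elts l. kpair a y \<in> elts ?e) \<longleftrightarrow>
      (\<forall>y\<in>elts (j z). \<exists>a\<in>elts (j l). kpair a y \<in> elts (j ?e))"
    by (rule transfer3[where R = "\<lambda>M z l e. \<forall>y\<in>elts z. \<exists>a\<in>elts l. kpair a y \<in> elts e"])
       (intro definable_intros)
  moreover have "\<forall>y\<in>elts z. \<exists>a\<in>elts l. kpair a y \<in> elts ?e"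
    unfolding g[symmetric] elts_lam by blast
  ultimately have surj: "\<forall>y\<in>elts (j z). \<exists>a\<in>elts l. kpair a y \<in> elts (j ?e)"
    by (simp add: j_l)
  show ?thesis
  proof
    show "j ` elts z \<subseteq> elts (j z)"
      by (auto simp: j_mem_iff)
    show "elts (j z) \<subseteq> j ` elts z"
    proof
      fix y assume "y \<in> elts (j z)"
      then obtain a where a: "a \<in> elts l" "kpair a y \<in> elts (j ?e)"
        using surj by blast
      have "y = ap (j ?e) a"
        using kpair_mem_is_fun[OF je a(1)] a(2) by simp
      also have "\<dots> = j (ap ?e a)"
        using j_ap[OF e a(1)] by (simp add: j_below[OF a(1)])
      finally show "y \<in> j ` elts z"
        using ap_in[OF e a(1)] by blast
    qed
  qed
qed

lemma j_subset_l:
  assumes "elts w \<subseteq> elts l"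
  shows "j w = w"
  using elts_j_small[OF subset_imp_lepoll[OF assms]] assms j_below
  by (intro extensionality) (force simp: image_iff)

text \<open>By elementarity \<open>j (funspace l u)\<close> consists of the functions in
  \<open>M\<close>. Closure under \<open>l\<close>-sequences places every function from
  \<open>l\<close> to \<open>j u\<close> in \<open>M\<close>.\<close>

lemma j_funspace: "j (funspace l u) = funspace l (j u)"
proof -
  have "(\<forall>f\<in>UNIV. f \<in> elts (funspace l u) \<longleftrightarrow> is_fun f l u) \<longleftrightarrow>
      (\<forall>f\<in>M. f \<in> elts (j (funspace l u)) \<longleftrightarrow> is_fun f (j l) (j u))"
    by (rule transfer3[where R = "\<lambda>M p l u. \<forall>f\<in>M. f \<in> elts p \<longleftrightarrow> is_fun f l u"])
       (intro definable_intros)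
  then have *: "\<forall>f\<in>M. f \<in> elts (j (funspace l u)) \<longleftrightarrow> is_fun f l (j u)"
    by (simp add: elts_funspace j_l)
  have "f \<in> M" if "is_fun f l (j u)" for f
  proof -
    have "ap f ` elts l \<subseteq> M"
      using ap_in[OF that] mem_j_in_M by blast
    then have "lam l (ap f) \<in> M"
      using closed by (simp add: closed_under_sequences_def lam_def)
    then show ?thesis
      using is_fun_eq_lam[OF that] by simp
  qed
  then show ?thesis
    using * mem_j_in_M by (intro extensionality) (auto simp: elts_funspace)
qed

end

section \<open>Definable operations and elementary embeddings\<close>

text \<open>\<open>Q\<close> is any HOL predicate, possibly not definable. The image
  \<open>j (sep x Q)\<close> is therefore computed below separately for each shape of
  \<open>Q\<close>.\<close>

definition sep :: "'v::zfc_universe \<Rightarrow> ('v \<Rightarrow> bool) \<Rightarrow> 'v" where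
  "sep x Q = mkset {f \<in> elts x. Q f}"

lemma elts_sep: "elts (sep x Q) = {f \<in> elts x. Q f}"
  unfolding sep_def by (intro elts_mkset is_set_subset[of _ x]) auto

lemma sep_cong: "(\<And>f. f \<in> elts x \<Longrightarrow> Q f \<longleftrightarrow> Q' f) \<Longrightarrow> sep x Q = sep x Q'"
  by (intro extensionality) (auto simp: elts_sep)

lemma kpair_mem_lam: "a \<in> elts x \<Longrightarrow> kpair a b \<in> elts (lam x g) \<longleftrightarrow> b = g a"
  by (auto simp: elts_lam kpair_inject)

section \<open>Images of functions and of separated subsets\<close>

context elementary
begin

lemma j_is_fun_lam: "g ` elts x \<subseteq> elts y \<Longrightarrow> is_fun (j (lam x g)) (j x) (j y)"
  by (simp add: j_is_fun_iff is_fun_lam)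

lemma kpair_mem_j_lam:
  assumes "f \<in> elts (j x)"
  shows "kpair f b \<in> elts (j (lam x g)) \<longleftrightarrow> b = ap (j (lam x g)) f"
proof -
  \<comment> \<open>The range of \<open>g\<close> is a set by replacement and serves as
    codomain.\<close>
  obtain y where "elts y = g ` elts x"
    using is_setE[OF replacement[of g x]] by blast
  then have "is_fun (j (lam x g)) (j x) (j y)"
    by (intro j_is_fun_lam) simp
  then show ?thesis
    using assms by (rule kpair_mem_is_fun)
qed

text \<open>The value lies two membership steps below its pair in the transitive class
  \<open>M\<close>. This makes it available as a witness for quantifiers over
  \<open>M\<close>.\<close>

lemma ap_j_lam_in_M:
  assumes "f \<in> elts (j x)"
  shows "ap (j (lam x g)) f \<in> M"
proof -
  have "kpair f (ap (j (lam x g)) f) \<in> M"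
    using kpair_mem_j_lam[OF assms] mem_j_in_M by blast
  moreover have "mkset {a, b} \<in> elts (kpair a b)" "b \<in> elts (mkset {a, b})" for a b :: 'v
    by (simp_all add: elts_kpair elts_mkset_doubleton)
  ultimately show ?thesis
    using transitive unfolding transitive_class_def by blast
qed

text \<open>Composition is expressed through three graphs: from \<open>a\<close> to \<open>q\<close>
  by \<open>?F\<close>, from \<open>q\<close> to \<open>w\<close> by \<open>h\<close>, and from
  \<open>a\<close> to \<open>w\<close> by \<open>?K\<close>.\<close>

lemma j_lam_comp:
  assumes g: "g ` elts x \<subseteq> elts y" and h: "is_fun h y z" and f: "f \<in> elts (j x)"
  shows "ap (j (lam x (\<lambda>a. ap h (g a)))) f = ap (j h) (ap (j (lam x g)) f)"
proof -
  let ?F = "lam x g" and ?K = "lam x (\<lambda>a. ap h (g a))"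
  have "(\<forall>a\<in>elts x. \<exists>q\<in>UNIV. \<exists>w\<in>UNIV. kpair a q \<in> elts ?F \<and> kpair q w \<in> elts h \<and> kpair a w \<in> elts ?K) \<longleftrightarrow>
      (\<forall>a\<in>elts (j x). \<exists>q\<in>M. \<exists>w\<in>M. kpair a q \<in> elts (j ?F) \<and> kpair q w \<in> elts (j h) \<and> kpair a w \<in> elts (j ?K))"
    by (rule transfer6[where R = "\<lambda>M x F h K u v. \<forall>a\<in>elts x. \<exists>q\<in>M. \<exists>w\<in>M.
        kpair a q \<in> elts F \<and> kpair q w \<in> elts h \<and> kpair a w \<in> elts K"]) (intro definable_intros)
  moreover have "kpair (g a) (ap h (g a)) \<in> elts h" if "a \<in> elts x" for a
    using that g kpair_mem_is_fun[OF h, of "g a"] by blast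
  ultimately obtain q w where "kpair f q \<in> elts (j ?F)" "kpair q w \<in> elts (j h)" "kpair f w \<in> elts (j ?K)"
    using f by (fastforce simp: kpair_mem_lam)
  moreover have "ap (j ?F) f \<in> elts (j y)"
    by (rule ap_in[OF j_is_fun_lam[OF g] f])
  moreover have "is_fun (j h) (j y) (j z)"
    using h by (simp add: j_is_fun_iff)
  ultimately show ?thesis
    using f by (simp add: kpair_mem_j_lam kpair_mem_is_fun)
qed

lemma j_lam_kpair:
  assumes f: "f \<in> elts (j x)"
  shows "ap (j (lam x (\<lambda>a. kpair (g a) (h a)))) f = kpair (ap (j (lam x g)) f) (ap (j (lam x h)) f)"
proof -
  let ?F = "lam x g" and ?G = "lam x h" and ?K = "lam x (\<lambda>a. kpair (g a) (h a))"
  have "(\<forall>a\<in>elts x. \<exists>q\<in>UNIV. \<exists>w\<in>UNIV. \<exists>p\<in>UNIV. p = kpair q w \<and>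
        kpair a q \<in> elts ?F \<and> kpair a w \<in> elts ?G \<and> kpair a p \<in> elts ?K) \<longleftrightarrow>
      (\<forall>a\<in>elts (j x). \<exists>q\<in>M. \<exists>w\<in>M. \<exists>p\<in>M. p = kpair q w \<and>
        kpair a q \<in> elts (j ?F) \<and> kpair a w \<in> elts (j ?G) \<and> kpair a p \<in> elts (j ?K))"
    by (rule transfer6[where R = "\<lambda>M x F G K u v. \<forall>a\<in>elts x. \<exists>q\<in>M. \<exists>w\<in>M. \<exists>p\<in>M. p = kpair q w \<and>
        kpair a q \<in> elts F \<and> kpair a w \<in> elts G \<and> kpair a p \<in> elts K"]) (intro definable_intros)
  then show ?thesis
    using f by (auto simp: kpair_mem_lam kpair_mem_j_lam)
qed

text \<open>A constant function maps into a singleton, and \<open>j\<close> sends that singleton to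
  the singleton of \<open>j c\<close>.\<close>

lemma j_lam_const:
  assumes f: "f \<in> elts (j x)"
  shows "ap (j (lam x (\<lambda>a. c))) f = j c"
proof -
  have "is_fun (j (lam x (\<lambda>a. c))) (j x) (j (mkset {c}))"
    by (intro j_is_fun_lam) (auto simp: elts_mkset is_set_singleton)
  from ap_in[OF this f] show ?thesis
    by (simp add: j_singleton elts_mkset is_set_singleton)
qed

lemma j_lam_tuple_code:
  assumes f: "f \<in> elts (j x)"
  shows "ap (j (lam x (\<lambda>a. tuple_code (map (\<lambda>t. g t a) ts)))) f =
    tuple_code (map (\<lambda>t. ap (j (lam x (g t))) f) ts)"
  by (induction ts) (simp_all add: j_lam_const[OF f] j_lam_kpair[OF f] j_empty)

text \<open>A preimage: membership of the value is witnessed by a point of the graph, and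
  \<open>j\<close> acts on graph and target. This is the clause for relation symbols.\<close>

lemma j_sep_mem:
  assumes f: "f \<in> elts (j x)"
  shows "f \<in> elts (j (sep x (\<lambda>a. g a \<in> elts r))) \<longleftrightarrow> ap (j (lam x g)) f \<in> elts (j r)"
proof -
  let ?F = "lam x g" and ?S = "sep x (\<lambda>a. g a \<in> elts r)"
  have "(\<forall>a\<in>elts x. a \<in> elts ?S \<longleftrightarrow> (\<exists>q\<in>UNIV. kpair a q \<in> elts ?F \<and> q \<in> elts r)) \<longleftrightarrow>
      (\<forall>a\<in>elts (j x). a \<in> elts (j ?S) \<longleftrightarrow> (\<exists>q\<in>M. kpair a q \<in> elts (j ?F) \<and> q \<in> elts (j r)))"
    by (rule transfer6[where R = "\<lambda>M x F S r u v. \<forall>a\<in>elts x. a \<in> elts S \<longleftrightarrow>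
        (\<exists>q\<in>M. kpair a q \<in> elts F \<and> q \<in> elts r)"]) (intro definable_intros)
  then show ?thesis
    using f ap_j_lam_in_M[OF f] by (auto simp: kpair_mem_lam kpair_mem_j_lam elts_sep)
qed

text \<open>Two functions agree at a point iff their graphs share a pair over it. This is the clause
  for equations.\<close>

lemma j_sep_eq:
  assumes f: "f \<in> elts (j x)"
  shows "f \<in> elts (j (sep x (\<lambda>a. g a = h a))) \<longleftrightarrow> ap (j (lam x g)) f = ap (j (lam x h)) f"
proof -
  let ?F = "lam x g" and ?G = "lam x h" and ?S = "sep x (\<lambda>a. g a = h a)"
  have "(\<forall>a\<in>elts x. a \<in> elts ?S \<longleftrightarrow> (\<exists>q\<in>UNIV. kpair a q \<in> elts ?F \<and> kpair a q \<in> elts ?G)) \<longleftrightarrow>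
      (\<forall>a\<in>elts (j x). a \<in> elts (j ?S) \<longleftrightarrow> (\<exists>q\<in>M. kpair a q \<in> elts (j ?F) \<and> kpair a q \<in> elts (j ?G)))"
    by (rule transfer6[where R = "\<lambda>M x F S G u v. \<forall>a\<in>elts x. a \<in> elts S \<longleftrightarrow>
        (\<exists>q\<in>M. kpair a q \<in> elts F \<and> kpair a q \<in> elts G)"]) (intro definable_intros)
  then show ?thesis
    using f ap_j_lam_in_M[OF f] by (auto simp: kpair_mem_lam kpair_mem_j_lam elts_sep)
qed

lemma j_sep_not:
  assumes f: "f \<in> elts (j x)"
  shows "f \<in> elts (j (sep x (\<lambda>a. \<not> Q a))) \<longleftrightarrow> f \<notin> elts (j (sep x Q))"
proof -
  have "(\<forall>a\<in>elts x. a \<in> elts (sep x (\<lambda>a. \<not> Q a)) \<longleftrightarrow> a \<notin> elts (sep x Q)) \<longleftrightarrow>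
      (\<forall>a\<in>elts (j x). a \<in> elts (j (sep x (\<lambda>a. \<not> Q a))) \<longleftrightarrow> a \<notin> elts (j (sep x Q)))"
    by (rule transfer3[where R = "\<lambda>M x S T. \<forall>a\<in>elts x. a \<in> elts S \<longleftrightarrow> a \<notin> elts T"])
       (intro definable_intros)
  then show ?thesis
    using f by (simp add: elts_sep)
qed

end

section \<open>Small intersections, evaluation and projections\<close>

context closed_elementary
begin

text \<open>The sets \<open>sep x (Q i)\<close> form a set \<open>z\<close> of size at most
  \<open>l\<close>, so \<open>j z\<close> contains only their images; the intersection of
  \<open>z\<close> goes to that of \<open>j z\<close>.\<close>

lemma j_sep_ball:
  assumes I: "I \<lesssim> elts l" and f: "f \<in> elts (j x)"
  shows "f \<in> elts (j (sep x (\<lambda>a. \<forall>i\<in>I. Q i a))) \<longleftrightarrow> (\<forall>i\<in>I. f \<in> elts (j (sep x (Q i))))"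
proof -
  let ?S = "sep x (\<lambda>a. \<forall>i\<in>I. Q i a)"
  obtain g where g: "I \<subseteq> g ` elts l"
    using I by (auto simp: lepoll_iff)
  \<comment> \<open>\<open>I\<close> is only a HOL set; re-indexing along \<open>l\<close> is what
    makes the family a set.\<close>
  obtain w where "elts w = (\<lambda>\<alpha>. sep x (Q (g \<alpha>))) ` elts l"
    using is_setE[OF replacement[of "\<lambda>\<alpha>. sep x (Q (g \<alpha>))" l]] by blast
  with g have "is_set ((\<lambda>i. sep x (Q i)) ` I)"
    by (intro is_set_subset[of _ w]) blast
  then obtain z where z: "elts z = (\<lambda>i. sep x (Q i)) ` I"
    by (rule is_setE)
  have "elts z \<lesssim> elts l"
    unfolding z using I image_lepoll lepoll_trans by blast
  note jz = elts_j_small[OF this]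
  have "(\<forall>a\<in>elts x. a \<in> elts ?S \<longleftrightarrow> (\<forall>y\<in>elts z. a \<in> elts y)) \<longleftrightarrow>
      (\<forall>a\<in>elts (j x). a \<in> elts (j ?S) \<longleftrightarrow> (\<forall>y\<in>elts (j z). a \<in> elts y))"
    by (rule transfer3[where R = "\<lambda>M x S z. \<forall>a\<in>elts x. a \<in> elts S \<longleftrightarrow> (\<forall>y\<in>elts z. a \<in> elts y)"])
       (intro definable_intros)
  then show ?thesis
    using f by (simp add: elts_sep z jz)
qed

lemma j_sep_bex:
  assumes I: "I \<lesssim> elts l" and f: "f \<in> elts (j x)"
  shows "f \<in> elts (j (sep x (\<lambda>a. \<exists>i\<in>I. Q i a))) \<longleftrightarrow> (\<exists>i\<in>I. f \<in> elts (j (sep x (Q i))))"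
  using j_sep_not[OF f, of "\<lambda>a. \<forall>i\<in>I. \<not> Q i a"] j_sep_ball[OF I f, of "\<lambda>i a. \<not> Q i a"]
  by (simp add: j_sep_not[OF f])

text \<open>Evaluation at \<open>\<alpha>\<close> is sent to evaluation at
  \<open>j \<alpha>\<close>, and \<open>j\<close> fixes \<open>\<alpha>\<close>.\<close>

lemma j_lam_ap:
  assumes \<alpha>: "\<alpha> \<in> elts l" and f: "f \<in> elts (funspace l (j u))"
  shows "ap (j (lam (funspace l u) (\<lambda>a. ap a \<alpha>))) f = ap f \<alpha>"
proof -
  let ?P = "funspace l u"
  let ?F = "lam ?P (\<lambda>a. ap a \<alpha>)"
  have "(\<forall>a\<in>elts ?P. \<exists>q\<in>UNIV. kpair a q \<in> elts ?F \<and> kpair \<alpha> q \<in> elts a) \<longleftrightarrow>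
      (\<forall>a\<in>elts (j ?P). \<exists>q\<in>M. kpair a q \<in> elts (j ?F) \<and> kpair (j \<alpha>) q \<in> elts a)"
    by (rule transfer3[where R = "\<lambda>M P F \<alpha>. \<forall>a\<in>elts P. \<exists>q\<in>M. kpair a q \<in> elts F \<and> kpair \<alpha> q \<in> elts a"])
       (intro definable_intros)
  moreover have "\<forall>a\<in>elts ?P. kpair \<alpha> (ap a \<alpha>) \<in> elts a"
    using \<alpha> by (auto simp: elts_funspace kpair_mem_is_fun)
  moreover have f': "f \<in> elts (j ?P)"
    using f by (simp add: j_funspace)
  ultimately obtain q where "kpair f q \<in> elts (j ?F)" "kpair \<alpha> q \<in> elts f"
    by (force simp: kpair_mem_lam j_below[OF \<alpha>])
  moreover have "is_fun f l (j u)"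
    using f by (simp add: elts_funspace)
  ultimately show ?thesis
    using kpair_mem_j_lam[OF f', of q "\<lambda>a. ap a \<alpha>"] kpair_mem_is_fun[OF _ \<alpha>, of f "j u" q] by simp
qed

text \<open>The clause for quantifiers: a projection that forgets the coordinates in
  \<open>W\<close>. The remaining coordinates form a subset of \<open>l\<close>, which
  \<open>j\<close> fixes.\<close>

lemma j_sep_ex_override:
  assumes f: "f \<in> elts (funspace l (j u))"
  shows "f \<in> elts (j (sep (funspace l u)
      (\<lambda>a. \<exists>b\<in>elts (funspace l u). Q b \<and> (\<forall>\<alpha>\<in>elts l - W. ap b \<alpha> = ap a \<alpha>)))) \<longleftrightarrow>
    (\<exists>b\<in>elts (funspace l (j u)). b \<in> elts (j (sep (funspace l u) Q)) \<and>
      (\<forall>\<alpha>\<in>elts l - W. ap b \<alpha> = ap f \<alpha>))"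
proof -
  let ?P = "funspace l u"
  let ?S = "sep ?P (\<lambda>a. \<exists>b\<in>elts ?P. Q b \<and> (\<forall>\<alpha>\<in>elts l - W. ap b \<alpha> = ap a \<alpha>))"
  define w where "w = sep l (\<lambda>\<alpha>. \<alpha> \<notin> W)"
  have w: "elts w = elts l - W"
    by (auto simp: w_def elts_sep)
  have jw: "j w = w"
    by (rule j_subset_l) (simp add: w)
  \<comment> \<open>Agreement is restated through graphs, which the formula can mention. The class
    \<open>N\<close> is \<open>UNIV\<close> before the transfer and \<open>M\<close> after
    it.\<close>
  have agree: "(\<forall>\<alpha>\<in>elts w. \<forall>y\<in>N. kpair \<alpha> y \<in> elts b \<longleftrightarrow> kpair \<alpha> y \<in> elts a) \<longleftrightarrow>
      (\<forall>\<alpha>\<in>elts l - W. ap b \<alpha> = ap a \<alpha>)"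
    if "a \<in> elts (funspace l z)" "b \<in> elts (funspace l z)" "elts z \<subseteq> N" for a b z N
  proof -
    have "(\<forall>y\<in>N. kpair \<alpha> y \<in> elts b \<longleftrightarrow> kpair \<alpha> y \<in> elts a) \<longleftrightarrow> ap b \<alpha> = ap a \<alpha>"
      if "\<alpha> \<in> elts l" for \<alpha>
      using that \<open>a \<in> _\<close> \<open>b \<in> _\<close> \<open>elts z \<subseteq> N\<close> ap_in[of b l z \<alpha>]
      by (auto simp: elts_funspace kpair_mem_is_fun)
    then show ?thesis
      unfolding w by simp
  qed
  have "(\<forall>a\<in>elts ?P. a \<in> elts ?S \<longleftrightarrow> (\<exists>b\<in>elts ?P. b \<in> elts (sep ?P Q) \<and>
        (\<forall>\<alpha>\<in>elts w. \<forall>y\<in>UNIV. kpair \<alpha> y \<in> elts b \<longleftrightarrow> kpair \<alpha> y \<in> elts a))) \<longleftrightarrow>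
      (\<forall>a\<in>elts (j ?P). a \<in> elts (j ?S) \<longleftrightarrow> (\<exists>b\<in>elts (j ?P). b \<in> elts (j (sep ?P Q)) \<and>
        (\<forall>\<alpha>\<in>elts (j w). \<forall>y\<in>M. kpair \<alpha> y \<in> elts b \<longleftrightarrow> kpair \<alpha> y \<in> elts a)))"
    by (rule transfer6[where R = "\<lambda>M P S T w x y. \<forall>a\<in>elts P. a \<in> elts S \<longleftrightarrow> (\<exists>b\<in>elts P. b \<in> elts T \<and>
        (\<forall>\<alpha>\<in>elts w. \<forall>y\<in>M. kpair \<alpha> y \<in> elts b \<longleftrightarrow> kpair \<alpha> y \<in> elts a))"]) (intro definable_intros)
  moreover have "\<forall>a\<in>elts ?P. a \<in> elts ?S \<longleftrightarrow> (\<exists>b\<in>elts ?P. b \<in> elts (sep ?P Q) \<and>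
        (\<forall>\<alpha>\<in>elts w. \<forall>y\<in>UNIV. kpair \<alpha> y \<in> elts b \<longleftrightarrow> kpair \<alpha> y \<in> elts a))"
    using agree[of _ u _ UNIV] by (simp add: elts_sep cong: bex_cong)
  moreover have "elts (j u) \<subseteq> M"
    using mem_j_in_M by blast
  ultimately show ?thesis
    using f agree[OF f _ \<open>elts (j u) \<subseteq> M\<close>] by (simp add: jw j_funspace cong: bex_cong)
qed

end

section \<open>Formulas\<close>

text \<open>Bound variables are included because they too need a coordinate in the
  \<open>l\<close>-sequence that codes an assignment.\<close>

primrec all_vars :: "'v fm \<Rightarrow> 'v set" where
  "all_vars (Eq t u) = trm_vars t \<union> trm_vars u"
| "all_vars (Rel r ts) = (\<Union>t \<in> set ts. trm_vars t)"
| "all_vars (Neg \<phi>) = all_vars \<phi>"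
| "all_vars (Conj I F) = (\<Union>i \<in> I. all_vars (F i))"
| "all_vars (Disj I F) = (\<Union>i \<in> I. all_vars (F i))"
| "all_vars (Exists X \<phi>) = X \<union> all_vars \<phi>"
| "all_vars (Forall X \<phi>) = X \<union> all_vars \<phi>"

text \<open>Quantifier blocks are not measured here; \<open>all_vars\<close> controls them.\<close>

primrec index_sets_le :: "'v set \<Rightarrow> 'v fm \<Rightarrow> bool" where
  "index_sets_le K (Eq t u) \<longleftrightarrow> True"
| "index_sets_le K (Rel r ts) \<longleftrightarrow> True"
| "index_sets_le K (Neg \<phi>) \<longleftrightarrow> index_sets_le K \<phi>"
| "index_sets_le K (Conj I F) \<longleftrightarrow> I \<lesssim> K \<and> (\<forall>i \<in> I. index_sets_le K (F i))"
| "index_sets_le K (Disj I F) \<longleftrightarrow> I \<lesssim> K \<and> (\<forall>i \<in> I. index_sets_le K (F i))"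
| "index_sets_le K (Exists X \<phi>) \<longleftrightarrow> index_sets_le K \<phi>"
| "index_sets_le K (Forall X \<phi>) \<longleftrightarrow> index_sets_le K \<phi>"

lemma index_sets_le_mono: "index_sets_le K \<phi> \<Longrightarrow> K \<lesssim> K' \<Longrightarrow> index_sets_le K' \<phi>"
  by (induction \<phi>) (auto intro: lepoll_trans)

lemma trm_val_cong: "(\<And>x. x \<in> trm_vars t \<Longrightarrow> s x = s' x) \<Longrightarrow> trm_val A s t = trm_val A s' t"
proof (induction t)
  case (App f ts)
  then have "map (trm_val A s) ts = map (trm_val A s') ts"
    by (intro map_cong refl App.IH) auto
  then show ?case by (simp only: trm_val.simps)
qed simp

lemma sat_cong: "(\<And>x. x \<in> all_vars \<phi> \<Longrightarrow> s x = s' x) \<Longrightarrow> sat A \<phi> s \<longleftrightarrow> sat A \<phi> s'"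
proof (induction \<phi> arbitrary: s s')
  case (Eq t u)
  then show ?case
    using trm_val_cong[of t s s' A] trm_val_cong[of u s s' A] by auto
next
  case (Rel r ts)
  then have "map (trm_val A s) ts = map (trm_val A s') ts"
    by (intro map_cong refl trm_val_cong) auto
  then show ?case by (simp only: sat.simps)
next
  case (Neg \<phi>)
  have "sat A \<phi> s \<longleftrightarrow> sat A \<phi> s'"
    using Neg.prems by (intro Neg.IH) simp
  then show ?case by simp
next
  case (Conj I F)
  have "sat A (F i) s \<longleftrightarrow> sat A (F i) s'" if "i \<in> I" for i
    using Conj.prems that by (intro Conj.IH) auto
  then show ?case by simp
next
  case (Disj I F)
  have "sat A (F i) s \<longleftrightarrow> sat A (F i) s'" if "i \<in> I" for i
    using Disj.prems that by (intro Disj.IH) auto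
  then show ?case by simp
next
  case (Exists X \<phi>)
  have "sat A \<phi> (override_on s t X) \<longleftrightarrow> sat A \<phi> (override_on s' t X)" for t
    using Exists.prems by (intro Exists.IH) (auto simp: override_on_def)
  then show ?case by simp
next
  case (Forall X \<phi>)
  have "sat A \<phi> (override_on s t X) \<longleftrightarrow> sat A \<phi> (override_on s' t X)" for t
    using Forall.prems by (intro Forall.IH) (auto simp: override_on_def)
  then show ?case by simp
qed

text \<open>Replaces the choice of values for \<open>X\<close> by the choice of a coded assignment
  that differs from \<open>f\<close> only on the coordinates of \<open>X\<close>. It is used for
  \<open>A\<close> with \<open>h\<close> the identity and for the extension with its bijection from
  \<open>j A\<close>.\<close>

lemma sat_override_iff:
  fixes C :: "'v::zfc_universe struct"
  assumes h: "bij_betw h (elts u) (elts (universe C))" and f: "f \<in> elts (funspace l u)"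
    and v: "\<And>x. v x \<in> elts l" "inj_on v V" and X: "X \<subseteq> V" and \<phi>: "all_vars \<phi> \<subseteq> V"
  shows "(\<exists>t. t ` X \<subseteq> elts (universe C) \<and> sat C \<phi> (override_on (\<lambda>x. h (ap f (v x))) t X)) \<longleftrightarrow>
    (\<exists>b\<in>elts (funspace l u). sat C \<phi> (\<lambda>x. h (ap b (v x))) \<and> (\<forall>\<alpha>\<in>elts l - v ` X. ap b \<alpha> = ap f \<alpha>))"
    (is "?L \<longleftrightarrow> ?R")
proof
  assume ?L
  then obtain t where t: "t ` X \<subseteq> elts (universe C)"
    and sat: "sat C \<phi> (override_on (\<lambda>x. h (ap f (v x))) t X)"
    by blast
  \<comment> \<open>The code of the overridden assignment: on coordinates of \<open>X\<close> the
    values of \<open>t\<close> pulled back along \<open>h\<close>, elsewhere those of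
    \<open>f\<close>.\<close>
  define g where "g \<alpha> = (if \<alpha> \<in> v ` X then inv_into (elts u) h (t (inv_into X v \<alpha>)) else ap f \<alpha>)" for \<alpha>
  have inv: "inv_into X v (v x) = x" if "x \<in> X" for x
    using that v(2) X by (meson inj_on_subset inv_into_f_f)
  have hinv: "inv_into (elts u) h y \<in> elts u" "h (inv_into (elts u) h y) = y"
    if "y \<in> elts (universe C)" for y
    using that h by (auto simp: bij_betw_def inv_into_into f_inv_into_f)
  have "g ` elts l \<subseteq> elts u"
    using f t hinv(1) inv by (auto simp: g_def elts_funspace ap_in)
  then have b: "lam l g \<in> elts (funspace l u)"
    by (simp add: elts_funspace is_fun_lam)
  have "h (g (v x)) = override_on (\<lambda>x. h (ap f (v x))) t X x" if "x \<in> V" for x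
  proof (cases "x \<in> X")
    case True
    then show ?thesis
      using t hinv(2) inv by (auto simp: g_def)
  next
    case False
    then have "v x \<notin> v ` X"
      using that v(2) X by (auto dest: inj_onD)
    with False show ?thesis
      by (simp add: g_def)
  qed
  with sat have "sat C \<phi> (\<lambda>x. h (ap (lam l g) (v x)))"
    using \<phi> by (subst sat_cong[where s' = "override_on (\<lambda>x. h (ap f (v x))) t X"])
      (auto simp: ap_lam v(1))
  moreover have "\<forall>\<alpha>\<in>elts l - v ` X. ap (lam l g) \<alpha> = ap f \<alpha>"
    by (simp add: ap_lam g_def)
  ultimately show ?R
    using b by blast
next
  assume ?R
  then obtain b where b: "b \<in> elts (funspace l u)" and sat: "sat C \<phi> (\<lambda>x. h (ap b (v x)))"
    and agree: "\<And>\<alpha>. \<alpha> \<in> elts l \<Longrightarrow> \<alpha> \<notin> v ` X \<Longrightarrow> ap b \<alpha> = ap f \<alpha>"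
    by blast
  let ?t = "\<lambda>x. h (ap b (v x))"
  have "?t ` X \<subseteq> elts (universe C)"
    using b v(1) h by (auto simp: elts_funspace ap_in bij_betw_def)
  moreover have "override_on (\<lambda>x. h (ap f (v x))) ?t X x = ?t x" if "x \<in> V" for x
  proof (cases "x \<in> X")
    case False
    then have "v x \<notin> v ` X"
      using that v(2) X by (auto dest: inj_onD)
    with False show ?thesis
      using agree[OF v(1)] by simp
  qed simp
  then have "sat C \<phi> (override_on (\<lambda>x. h (ap f (v x))) ?t X)"
    using sat \<phi> by (subst sat_cong[where s' = ?t]) auto
  ultimately show ?L
    by blast
qed

section \<open>The extension\<close>

text \<open>\<open>v\<close> gives each variable a coordinate below \<open>l\<close>. It is total,
  so that every code yields a full assignment, and injective on the variables \<open>V\<close> of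
  the sentence.\<close>

locale tall_extension = closed_elementary j M \<kappa> l
  for j :: "'v::zfc_universe \<Rightarrow> 'v" and M :: "'v set" and \<kappa> l :: 'v +
  fixes \<tau> :: "'v language" and A :: "'v struct" and V :: "'v set" and v :: "'v \<Rightarrow> 'v"
  assumes A: "is_structure \<tau> A" and v_in: "\<And>x. v x \<in> elts l" and inj_v: "inj_on v V"
begin

definition h :: "'v \<Rightarrow> 'v" where
  "h y = (if y \<in> j ` elts (universe A) then inv j y else kpair (universe A) y)"

definition k :: "'v \<Rightarrow> 'v" where
  "k = inv_into (elts (j (universe A))) h"

text \<open>\<open>rel_int\<close> and \<open>fun_int\<close> are HOL functions;
  \<open>rel_set\<close> and \<open>fun_graph\<close> code them as elements of the universe, to
  which \<open>j\<close> applies.\<close>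

definition rel_set :: "'v \<Rightarrow> 'v" where
  "rel_set r = sep (tuple_set (universe A) (rel_arity \<tau> r))
     (\<lambda>c. \<exists>xs \<in> tuples A (rel_arity \<tau> r). c = tuple_code xs \<and> rel_int A r xs)"

definition fun_graph :: "'v \<Rightarrow> 'v" where
  "fun_graph g = lam (tuple_set (universe A) (fun_arity \<tau> g))
     (\<lambda>c. fun_int A g (inv_into (tuples A (fun_arity \<tau> g)) tuple_code c))"

text \<open>An isomorphic copy of \<open>j A\<close>, with a symbol \<open>r\<close> of \<open>\<tau>\<close> read as the symbol \<open>j r\<close> of \<open>j \<tau>\<close>.\<close>

definition B :: "'v struct" where
  "B = \<lparr>universe = mkset (h ` elts (j (universe A))),
        rel_int = \<lambda>r xs. tuple_code (map k xs) \<in> elts (j (rel_set r)),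
        fun_int = \<lambda>g xs. h (ap (j (fun_graph g)) (tuple_code (map k xs)))\<rparr>"

section \<open>The copy of \<open>j A\<close> as an extension of \<open>A\<close>\<close>

lemma elts_universe_B: "elts (universe B) = h ` elts (j (universe A))"
  by (simp add: B_def elts_mkset replacement)

lemma inj_j: "inj j"
  by (rule injI) (simp add: j_eq_iff)

lemma h_j: "x \<in> elts (universe A) \<Longrightarrow> h (j x) = x"
  by (simp add: h_def inj_j)

text \<open>The two branches of \<open>h\<close> cannot collide: a pair whose first component is
  \<open>universe A\<close> is not an element of \<open>universe A\<close>.\<close>

lemma bij_h: "bij_betw h (elts (j (universe A))) (elts (universe B))"
proof -
  have "inj_on h (elts (j (universe A)))"
    unfolding h_def inj_on_def
    by (auto simp: kpair_inject inj_j j_mem_iff kpair_notin_first)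
  then show ?thesis
    by (simp add: bij_betw_def elts_universe_B)
qed

lemma k_h: "y \<in> elts (j (universe A)) \<Longrightarrow> k (h y) = y"
  using bij_h by (simp add: k_def bij_betw_def)

lemma k_in: "x \<in> elts (universe B) \<Longrightarrow> k x \<in> elts (j (universe A))"
  by (auto simp: elts_universe_B k_h)

lemma h_k: "x \<in> elts (universe B) \<Longrightarrow> h (k x) = x"
  by (auto simp: elts_universe_B k_h)

lemma k_eq_j: "x \<in> elts (universe A) \<Longrightarrow> k x = j x"
  using k_h[of "j x"] by (simp add: h_j j_mem_iff)

lemma universe_subset: "elts (universe A) \<subseteq> elts (universe B)"
proof
  fix x assume "x \<in> elts (universe A)"
  then show "x \<in> elts (universe B)"
    unfolding elts_universe_B by (intro image_eqI[of _ _ "j x"]) (simp_all add: h_j j_mem_iff)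
qed

lemma elts_tuple_set_tuples: "elts (tuple_set (universe C) n) = tuple_code ` tuples C n"
  by (simp add: elts_tuple_set tuples_def)

lemma decode: "xs \<in> tuples A n \<Longrightarrow> inv_into (tuples A n) tuple_code (tuple_code xs) = xs"
  by (rule inv_into_f_f) (auto simp: inj_on_def tuples_def tuple_code_inject)

lemma tuple_code_rel_set:
  assumes "xs \<in> tuples A (rel_arity \<tau> r)"
  shows "tuple_code xs \<in> elts (rel_set r) \<longleftrightarrow> rel_int A r xs"
proof -
  have "ys = xs" if "ys \<in> tuples A (rel_arity \<tau> r)" "tuple_code xs = tuple_code ys" for ys
    using that assms tuple_code_inject[of xs ys] by (auto simp: tuples_def)
  then show ?thesis
    using assms by (auto simp: rel_set_def elts_sep elts_tuple_set_tuples)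
qed

lemma ap_fun_graph:
  assumes "xs \<in> tuples A (fun_arity \<tau> g)"
  shows "ap (fun_graph g) (tuple_code xs) = fun_int A g xs"
  using assms by (simp add: fun_graph_def ap_lam elts_tuple_set_tuples decode)

lemma is_fun_fun_graph:
  assumes "g \<in> elts (fun_syms \<tau>)"
  shows "is_fun (fun_graph g) (tuple_set (universe A) (fun_arity \<tau> g)) (universe A)"
  using assms A by (auto simp: fun_graph_def is_fun_lam elts_tuple_set_tuples decode is_structure_def)

lemma is_fun_j_fun_graph:
  assumes "g \<in> elts (fun_syms \<tau>)"
  shows "is_fun (j (fun_graph g)) (tuple_set (j (universe A)) (fun_arity \<tau> g)) (j (universe A))"
  using is_fun_fun_graph[OF assms] by (simp add: j_is_fun_iff flip: j_tuple_set)

lemma structure_B: "is_structure \<tau> B"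
  unfolding is_structure_def
proof (intro conjI ballI)
  show "elts (universe B) \<noteq> {}"
    using A universe_subset by (auto simp: is_structure_def)
next
  fix g xs assume g: "g \<in> elts (fun_syms \<tau>)" and xs: "xs \<in> tuples B (fun_arity \<tau> g)"
  have "tuple_code (map k xs) \<in> elts (tuple_set (j (universe A)) (fun_arity \<tau> g))"
    using xs k_in unfolding elts_tuple_set by (intro imageI) (auto simp: tuples_def)
  from ap_in[OF is_fun_j_fun_graph[OF g] this] show "fun_int B g xs \<in> elts (universe B)"
    unfolding elts_universe_B by (simp add: B_def)
qed

text \<open>On elements of \<open>A\<close> the map \<open>k\<close> is \<open>j\<close>, so both
  clauses reduce to \<open>j\<close> preserving membership and application.\<close>

lemma substructure_B: "substructure \<tau> A B"
  unfolding substructure_def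
proof (intro conjI ballI universe_subset)
  fix r xs assume "r \<in> elts (rel_syms \<tau>)" and xs: "xs \<in> tuples A (rel_arity \<tau> r)"
  have "map k xs = map j xs"
    using xs k_eq_j by (auto simp: tuples_def)
  then have "rel_int B r xs \<longleftrightarrow> j (tuple_code xs) \<in> elts (j (rel_set r))"
    by (simp add: B_def j_tuple_code del: map_eq_conv)
  then show "rel_int A r xs = rel_int B r xs"
    using xs by (simp add: j_mem_iff tuple_code_rel_set)
next
  fix g xs assume g: "g \<in> elts (fun_syms \<tau>)" and xs: "xs \<in> tuples A (fun_arity \<tau> g)"
  have "map k xs = map j xs"
    using xs k_eq_j by (auto simp: tuples_def)
  then have "fun_int B g xs = h (ap (j (fun_graph g)) (j (tuple_code xs)))"
    by (simp add: B_def j_tuple_code del: map_eq_conv)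
  also have "\<dots> = h (j (fun_int A g xs))"
    using j_ap[OF is_fun_fun_graph[OF g], of "tuple_code xs"] xs
    by (simp add: elts_tuple_set_tuples ap_fun_graph)
  also have "\<dots> = fun_int A g xs"
    using A g xs by (intro h_j) (auto simp: is_structure_def)
  finally show "fun_int A g xs = fun_int B g xs" ..
qed

section \<open>Satisfaction in the extension\<close>

abbreviation asgs :: 'v where
  "asgs \<equiv> funspace l (universe A)"

text \<open>An \<open>l\<close>-sequence \<open>a\<close> in \<open>asgs\<close> codes the
  assignment that gives \<open>x\<close> the entry at \<open>v x\<close>; the term becomes a
  function on such codes.\<close>

abbreviation trm_graph :: "'v trm \<Rightarrow> 'v" where
  "trm_graph t \<equiv> lam asgs (\<lambda>a. trm_val A (\<lambda>x. ap a (v x)) t)"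

lemma trm_val_in:
  assumes "is_structure \<tau> C" "wf_trm \<tau> t" "range s \<subseteq> elts (universe C)"
  shows "trm_val C s t \<in> elts (universe C)"
  using assms(2)
proof (induction t)
  case (Var x)
  then show ?case using assms(3) by auto
next
  case (App g ts)
  then have "map (trm_val C s) ts \<in> tuples C (fun_arity \<tau> g)"
    by (auto simp: tuples_def)
  with App.prems assms(1) show ?case
    by (simp add: is_structure_def)
qed

lemma asg_in: "a \<in> elts (funspace l u) \<Longrightarrow> ap a (v x) \<in> elts u"
  by (rule ap_in[OF _ v_in]) (simp add: elts_funspace)

lemma range_asg: "a \<in> elts (funspace l u) \<Longrightarrow> range (\<lambda>x. ap a (v x)) \<subseteq> elts u"
  using asg_in by blast

text \<open>Variables are evaluations and applications are compositions with a tupling, and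
  \<open>j\<close> respects both. The membership half is carried along because \<open>k\<close>
  inverts \<open>h\<close> only on \<open>j A\<close>.\<close>

lemma j_trm_graph:
  assumes f: "f \<in> elts (funspace l (j (universe A)))" and t: "wf_trm \<tau> t"
  shows "ap (j (trm_graph t)) f \<in> elts (j (universe A)) \<and>
    trm_val B (\<lambda>x. h (ap f (v x))) t = h (ap (j (trm_graph t)) f)"
  using t
proof (induction t)
  case (Var x)
  have "ap (j (trm_graph (Var x))) f = ap f (v x)"
    using j_lam_ap[OF v_in f] by simp
  then show ?case
    using asg_in[OF f] by simp
next
  case (App g ts)
  have f': "f \<in> elts (j asgs)"
    using f by (simp add: j_funspace)
  let ?F = "\<lambda>a. tuple_code (map (\<lambda>t. trm_val A (\<lambda>x. ap a (v x)) t) ts)"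
  have g: "g \<in> elts (fun_syms \<tau>)" and len: "length ts = fun_arity \<tau> g"
    using App.prems by auto
  have tup: "map (\<lambda>t. trm_val A (\<lambda>x. ap a (v x)) t) ts \<in> tuples A (fun_arity \<tau> g)"
    if "a \<in> elts asgs" for a
    using App.prems that trm_val_in[OF A] range_asg by (fastforce simp: tuples_def)
  have "trm_graph (App g ts) = lam asgs (\<lambda>a. ap (fun_graph g) (?F a))"
    using tup unfolding lam_def by (intro arg_cong[of _ _ mkset] image_cong) (simp_all add: ap_fun_graph)
  then have "ap (j (trm_graph (App g ts))) f = ap (j (lam asgs (\<lambda>a. ap (fun_graph g) (?F a)))) f"
    by simp
  also have "\<dots> = ap (j (fun_graph g)) (ap (j (lam asgs ?F)) f)"
    using tup f' by (intro j_lam_comp[OF _ is_fun_fun_graph[OF g]]) (auto simp: elts_tuple_set_tuples)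
  also have "ap (j (lam asgs ?F)) f = tuple_code (map (\<lambda>t. ap (j (trm_graph t)) f) ts)"
    by (rule j_lam_tuple_code[OF f'])
  finally have eq: "ap (j (trm_graph (App g ts))) f =
      ap (j (fun_graph g)) (tuple_code (map (\<lambda>t. ap (j (trm_graph t)) f) ts))" .
  have IH: "ap (j (trm_graph t)) f \<in> elts (j (universe A))"
    "k (trm_val B (\<lambda>x. h (ap f (v x))) t) = ap (j (trm_graph t)) f" if "t \<in> set ts" for t
    using App.IH[OF that] App.prems that k_h by auto
  have "tuple_code (map (\<lambda>t. ap (j (trm_graph t)) f) ts) \<in> elts (tuple_set (j (universe A)) (fun_arity \<tau> g))"
    using IH(1) len unfolding elts_tuple_set by (intro imageI) auto
  then have "ap (j (trm_graph (App g ts))) f \<in> elts (j (universe A))"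
    unfolding eq by (rule ap_in[OF is_fun_j_fun_graph[OF g]])
  moreover have "map k (map (trm_val B (\<lambda>x. h (ap f (v x)))) ts) = map (\<lambda>t. ap (j (trm_graph t)) f) ts"
    using IH(2) by simp
  then have "trm_val B (\<lambda>x. h (ap f (v x))) (App g ts) = h (ap (j (trm_graph (App g ts))) f)"
    unfolding eq by (simp add: B_def del: map_map map_eq_conv)
  ultimately show ?case ..
qed

abbreviation sat_set :: "'v fm \<Rightarrow> 'v" where
  "sat_set \<phi> \<equiv> sep asgs (\<lambda>a. sat A \<phi> (\<lambda>x. ap a (v x)))"

lemma sat_Exists_A:
  assumes "a \<in> elts asgs" "X \<subseteq> V" "all_vars \<phi> \<subseteq> V"
  shows "sat A (Exists X \<phi>) (\<lambda>x. ap a (v x)) \<longleftrightarrow>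
    (\<exists>b\<in>elts asgs. sat A \<phi> (\<lambda>x. ap b (v x)) \<and> (\<forall>\<alpha>\<in>elts l - v ` X. ap b \<alpha> = ap a \<alpha>))"
  using sat_override_iff[where h = "\<lambda>x. x" and C = A, OF _ assms(1) v_in inj_v assms(2,3)]
  by (simp add: bij_betw_def)

text \<open>The induction hypothesis is a premise here, so that the lemma also serves universal
  quantifiers, with \<open>Neg \<phi>\<close> in place of \<open>\<phi>\<close>.\<close>

lemma j_sat_set_Exists:
  assumes f: "f \<in> elts (funspace l (j (universe A)))" and X: "X \<subseteq> V" and \<phi>: "all_vars \<phi> \<subseteq> V"
    and IH: "\<And>f. f \<in> elts (funspace l (j (universe A))) \<Longrightarrow>
      f \<in> elts (j (sat_set \<phi>)) \<longleftrightarrow> sat B \<phi> (\<lambda>x. h (ap f (v x)))"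
  shows "f \<in> elts (j (sat_set (Exists X \<phi>))) \<longleftrightarrow> sat B (Exists X \<phi>) (\<lambda>x. h (ap f (v x)))"
proof -
  have "sat_set (Exists X \<phi>) = sep asgs (\<lambda>a. \<exists>b\<in>elts asgs. sat A \<phi> (\<lambda>x. ap b (v x)) \<and>
      (\<forall>\<alpha>\<in>elts l - v ` X. ap b \<alpha> = ap a \<alpha>))"
    by (rule sep_cong) (rule sat_Exists_A[OF _ X \<phi>])
  then show ?thesis
    using j_sep_ex_override[OF f] IH sat_override_iff[OF bij_h f v_in inj_v X \<phi>]
    by (simp cong: bex_cong)
qed

text \<open>The analogue of Los's theorem for the extension \<open>B\<close>.\<close>

lemma j_sat_set:
  assumes "wf_fm \<eta> \<tau> \<phi>" "index_sets_le (elts l) \<phi>" "all_vars \<phi> \<subseteq> V"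
    and "f \<in> elts (funspace l (j (universe A)))"
  shows "f \<in> elts (j (sat_set \<phi>)) \<longleftrightarrow> sat B \<phi> (\<lambda>x. h (ap f (v x)))"
  using assms
proof (induction \<phi> arbitrary: f)
  case (Eq t u)
  then have f': "f \<in> elts (j asgs)"
    by (simp add: j_funspace)
  \<comment> \<open>Equality of term values in \<open>B\<close> has to be read back as equality in
    \<open>j A\<close>.\<close>
  have inj: "h y = h z \<longleftrightarrow> y = z" if "y \<in> elts (j (universe A))" "z \<in> elts (j (universe A))" for y z
    using that k_h by metis
  show ?case
    using Eq.prems j_sep_eq[OF f'] j_trm_graph[OF Eq.prems(4), of t] j_trm_graph[OF Eq.prems(4), of u]
    by (simp add: inj)
next
  case (Rel r ts)
  then have f': "f \<in> elts (j asgs)"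
    by (simp add: j_funspace)
  let ?F = "\<lambda>a. tuple_code (map (\<lambda>t. trm_val A (\<lambda>x. ap a (v x)) t) ts)"
  have tup: "map (\<lambda>t. trm_val A (\<lambda>x. ap a (v x)) t) ts \<in> tuples A (rel_arity \<tau> r)"
    if "a \<in> elts asgs" for a
    using Rel.prems(1) that trm_val_in[OF A] range_asg by (fastforce simp: tuples_def)
  have "sat_set (Rel r ts) = sep asgs (\<lambda>a. ?F a \<in> elts (rel_set r))"
    using tup by (intro sep_cong) (simp add: tuple_code_rel_set)
  then have "f \<in> elts (j (sat_set (Rel r ts))) \<longleftrightarrow>
      tuple_code (map (\<lambda>t. ap (j (trm_graph t)) f) ts) \<in> elts (j (rel_set r))"
    using j_sep_mem[OF f', of ?F] by (simp add: j_lam_tuple_code[OF f'])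
  moreover have "map k (map (trm_val B (\<lambda>x. h (ap f (v x)))) ts) = map (\<lambda>t. ap (j (trm_graph t)) f) ts"
    using Rel.prems(1) j_trm_graph[OF Rel.prems(4)] k_h by auto
  ultimately show ?case
    by (simp add: B_def del: map_map map_eq_conv)
next
  case (Neg \<phi>)
  then have f': "f \<in> elts (j asgs)"
    by (simp add: j_funspace)
  show ?case
    using Neg.IH Neg.prems by (simp add: j_sep_not[OF f'])
next
  case (Conj I F)
  then have f': "f \<in> elts (j asgs)"
    by (simp add: j_funspace)
  have I: "I \<lesssim> elts l"
    using Conj.prems by simp
  have "f \<in> elts (j (sat_set (F i))) \<longleftrightarrow> sat B (F i) (\<lambda>x. h (ap f (v x)))" if "i \<in> I" for i
    using Conj.prems that by (intro Conj.IH) auto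
  then show ?case
    by (simp add: j_sep_ball[OF I f'])
next
  case (Disj I F)
  then have f': "f \<in> elts (j asgs)"
    by (simp add: j_funspace)
  have I: "I \<lesssim> elts l"
    using Disj.prems by simp
  have "f \<in> elts (j (sat_set (F i))) \<longleftrightarrow> sat B (F i) (\<lambda>x. h (ap f (v x)))" if "i \<in> I" for i
    using Disj.prems that by (intro Disj.IH) auto
  then show ?case
    by (simp add: j_sep_bex[OF I f'])
next
  case (Exists X \<phi>)
  then show ?case
    by (intro j_sat_set_Exists) auto
next
  case (Forall X \<phi>)
  then have f': "f \<in> elts (j asgs)"
    by (simp add: j_funspace)
  \<comment> \<open>The universal case is reduced to the existential one by duality.\<close>
  have "f \<in> elts (j (sat_set (Exists X (Neg \<phi>)))) \<longleftrightarrow> sat B (Exists X (Neg \<phi>)) (\<lambda>x. h (ap f (v x)))"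
  proof (rule j_sat_set_Exists)
    fix f assume f: "f \<in> elts (funspace l (j (universe A)))"
    then have "f \<in> elts (j asgs)"
      by (simp add: j_funspace)
    with f show "f \<in> elts (j (sat_set (Neg \<phi>))) \<longleftrightarrow> sat B (Neg \<phi>) (\<lambda>x. h (ap f (v x)))"
      using Forall by (simp add: j_sep_not)
  qed (use Forall.prems in auto)
  moreover have dual: "sat C (Forall X \<phi>) s \<longleftrightarrow> \<not> sat C (Exists X (Neg \<phi>)) s" for C s
    by simp
  ultimately show ?case
    unfolding dual j_sep_not[OF f'] by blast
qed

text \<open>In \<open>A\<close> every code satisfies \<open>\<phi>\<close>, so
  \<open>sat_set \<phi>\<close> is all of \<open>asgs\<close>, and its image consists of all codes
  over \<open>j A\<close>.\<close>

lemma L_models_B: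
  assumes \<phi>: "wf_fm \<eta> \<tau> \<phi>" "index_sets_le (elts l) \<phi>" "all_vars \<phi> \<subseteq> V" and "L_models A \<phi>"
  shows "L_models B \<phi>"
  unfolding L_models_def
proof (intro allI impI)
  fix s :: "'v \<Rightarrow> 'v" assume s: "range s \<subseteq> elts (universe B)"
  \<comment> \<open>The code of \<open>s\<close>: a coordinate is traced back to its variable, and
    the value is moved from \<open>B\<close> to \<open>j A\<close> by \<open>k\<close>.\<close>
  define f where "f = lam l (\<lambda>\<alpha>. k (s (inv_into V v \<alpha>)))"
  have f: "f \<in> elts (funspace l (j (universe A)))"
    using s k_in by (auto simp: f_def elts_funspace is_fun_lam)
  have s_in: "s x \<in> elts (universe B)" for x
    using s by auto
  have "sat_set \<phi> = asgs"
    using \<open>L_models A \<phi>\<close> range_asg by (intro extensionality) (auto simp: elts_sep L_models_def)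
  then have "sat B \<phi> (\<lambda>x. h (ap f (v x)))"
    using j_sat_set[OF \<phi> f] f by (simp add: j_funspace)
  moreover have "h (ap f (v x)) = s x" if "x \<in> V" for x
    using that by (simp add: f_def ap_lam v_in inj_v h_k[OF s_in])
  ultimately show "sat B \<phi> s"
    using \<phi>(3) by (subst sat_cong[where s' = "\<lambda>x. h (ap f (v x))"]) auto
qed

end

section \<open>Bounding formulas below a regular cardinal\<close>

lemma regular_cardinal_Ordinal: "regular_cardinal \<eta> \<Longrightarrow> Ordinal \<eta>"
  by (simp add: regular_cardinal_def Cardinal_def)

text \<open>A union of two sets is a family indexed by \<open>bool\<close>, and finite index sets
  are below the infinite \<open>\<eta>\<close>.\<close>

lemma regular_Un_lesspoll:
  assumes "regular_cardinal \<eta>" "A \<prec> elts \<eta>" "B \<prec> elts \<eta>"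
  shows "A \<union> B \<prec> elts \<eta>"
proof -
  have "(UNIV :: bool set) \<prec> elts \<eta>"
    using assms(1) by (intro finite_lesspoll_infinite) (auto simp: regular_cardinal_def)
  then have "(\<Union>b. if b then A else B) \<prec> elts \<eta>"
    by (rule regular_UN_lesspoll[OF assms(1)]) (use assms in auto)
  then show ?thesis
    by (simp add: UNIV_bool Un_commute)
qed

lemma finite_trm_vars: "finite (trm_vars t)"
  by (induction t) auto

lemma all_vars_lesspoll:
  assumes \<eta>: "regular_cardinal \<eta>" and "wf_fm \<eta> \<tau> \<phi>"
  shows "all_vars \<phi> \<prec> elts \<eta>"
proof -
  have "infinite (elts \<eta>)"
    using \<eta> by (simp add: regular_cardinal_def)
  note fin = finite_lesspoll_infinite[OF this]
  from assms(2) show ?thesis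
    by (induction \<phi>)
       (auto intro: fin finite_trm_vars regular_UN_lesspoll[OF \<eta>] regular_Un_lesspoll[OF \<eta>])
qed

text \<open>The step for conjunctions and disjunctions: regularity merges the bounds of the
  components and of the index set into one.\<close>

lemma index_sets_le_bound_family:
  fixes \<eta> :: "'v::zfc_universe"
  assumes \<eta>: "regular_cardinal \<eta>" and I: "I \<prec> elts \<eta>"
    and F: "\<And>i. i \<in> I \<Longrightarrow> \<exists>\<beta>\<in>elts \<eta>. index_sets_le (elts \<beta>) (F i)"
  shows "\<exists>\<beta>\<in>elts \<eta>. I \<lesssim> elts \<beta> \<and> (\<forall>i\<in>I. index_sets_le (elts \<beta>) (F i))"
proof -
  obtain g where g: "\<And>i. i \<in> I \<Longrightarrow> g i \<in> elts \<eta> \<and> index_sets_le (elts (g i)) (F i)"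
    using F by metis
  obtain \<beta>1 where \<beta>1: "\<beta>1 \<in> elts \<eta>" "\<And>i. i \<in> I \<Longrightarrow> g i \<in> elts \<beta>1"
    using regular_bound_family[OF \<eta> I] g by metis
  obtain \<beta>2 where \<beta>2: "\<beta>2 \<in> elts \<eta>" "I \<lesssim> elts \<beta>2"
    using regular_bound[OF \<eta> I] by metis
  obtain \<beta> where \<beta>: "\<beta> \<in> elts \<eta>" "\<beta>1 \<in> elts \<beta>" "\<beta>2 \<in> elts \<beta>"
    using regular_max[OF \<eta> \<beta>1(1) \<beta>2(1)] by metis
  have ord: "Ordinal \<beta>"
    using regular_cardinal_Ordinal[OF \<eta>] \<beta>(1) by (rule Ordinal_in)
  have "index_sets_le (elts \<beta>) (F i)" if "i \<in> I" for i
    using g[OF that] Ordinal_subset[OF ord Ordinal_trans[OF ord \<beta>1(2)[OF that] \<beta>(2)]]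
    by (blast intro: index_sets_le_mono subset_imp_lepoll)
  moreover have "I \<lesssim> elts \<beta>"
    using \<beta>2(2) Ordinal_subset[OF ord \<beta>(3)] by (blast intro: lepoll_trans subset_imp_lepoll)
  ultimately show ?thesis
    using \<beta>(1) by blast
qed

lemma index_sets_le_bound:
  assumes \<eta>: "regular_cardinal \<eta>" and "wf_fm \<eta> \<tau> \<phi>"
  shows "\<exists>\<beta>\<in>elts \<eta>. index_sets_le (elts \<beta>) \<phi>"
proof -
  have "elts \<eta> \<noteq> {}"
    using \<eta> by (auto simp: regular_cardinal_def)
  then show ?thesis
    using assms(2) by (induction \<phi>) (auto simp: index_sets_le_bound_family[OF \<eta>])
qed

lemma fm_bound:
  fixes \<eta> :: "'v::zfc_universe"
  assumes \<eta>: "regular_cardinal \<eta>" and \<phi>: "wf_fm \<eta> \<tau> \<phi>"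
  obtains l where "Cardinal l" "l \<in> elts \<eta>" "elts l \<noteq> {}" "index_sets_le (elts l) \<phi>"
    "all_vars \<phi> \<lesssim> elts l"
proof -
  \<comment> \<open>One more element is counted so that \<open>l\<close> is non-empty even if no
    variable occurs.\<close>
  have "{undefined} \<prec> elts \<eta>"
    using \<eta> by (intro finite_lesspoll_infinite) (auto simp: regular_cardinal_def)
  then obtain \<beta>1 where \<beta>1: "\<beta>1 \<in> elts \<eta>" "{undefined} \<union> all_vars \<phi> \<lesssim> elts \<beta>1"
    using regular_bound[OF \<eta> regular_Un_lesspoll[OF \<eta> _ all_vars_lesspoll[OF \<eta> \<phi>]]] by metis
  obtain \<beta>2 where \<beta>2: "\<beta>2 \<in> elts \<eta>" "index_sets_le (elts \<beta>2) \<phi>"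
    using index_sets_le_bound[OF \<eta> \<phi>] by blast
  obtain \<beta> where \<beta>: "\<beta> \<in> elts \<eta>" "\<beta>1 \<in> elts \<beta>" "\<beta>2 \<in> elts \<beta>"
    using regular_max[OF \<eta> \<beta>1(1) \<beta>2(1)] by metis
  note ord\<eta> = regular_cardinal_Ordinal[OF \<eta>]
  have ord: "Ordinal \<beta>"
    using ord\<eta> \<beta>(1) by (rule Ordinal_in)
  \<comment> \<open>Closure is available for cardinals only. Passing to the cardinality of
    \<open>\<beta>\<close> stays below \<open>\<eta>\<close> and keeps all size bounds.\<close>
  obtain l where l: "Cardinal l" "ord_le l \<beta>" "elts l \<approx> elts \<beta>"
    using ex_Cardinal_eqpoll[OF ord] by metis
  have \<beta>l: "elts \<beta> \<lesssim> elts l"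
    using l(3) eqpoll_imp_lepoll eqpoll_sym by blast
  have le: "elts \<beta>1 \<lesssim> elts l" "elts \<beta>2 \<lesssim> elts l"
    using \<beta>l Ordinal_subset[OF ord \<beta>(2)] Ordinal_subset[OF ord \<beta>(3)]
    by (blast intro: lepoll_trans subset_imp_lepoll)+
  have "{undefined} \<union> all_vars \<phi> \<lesssim> elts l"
    using \<beta>1(2) le(1) by (rule lepoll_trans)
  then have "elts l \<noteq> {}" "all_vars \<phi> \<lesssim> elts l"
    by (auto simp: lepoll_def)
  moreover have "l \<in> elts \<eta>"
    using ord\<eta> l(2) \<beta>(1) by (rule ord_le_mem)
  ultimately show thesis
    using that l(1) index_sets_le_mono[OF \<beta>2(2) le(2)] by blast
qed

section \<open>Upward Loewenheim-Skolem-Tarski numbers\<close>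

lemma supreme_ULST_property:
  fixes \<delta> \<eta> :: "'v::zfc_universe"
  assumes \<delta>: "supreme_for_tallness \<delta>" and \<eta>: "regular_cardinal \<eta>" "ord_le \<eta> \<delta>"
  shows "ULST_property (L_sentences \<eta>) L_models \<delta>"
  unfolding ULST_property_def
proof (intro allI impI, elim conjE)
  fix \<tau> :: "'v language" and \<phi> A \<gamma> \<gamma>'
  assume \<phi>: "\<phi> \<in> L_sentences \<eta> \<tau>" and A: "is_structure \<tau> A" "L_models A \<phi>"
    and \<gamma>: "Cardinal \<gamma>" "elts (universe A) \<approx> elts \<gamma>" "ord_le \<delta> \<gamma>"
    and \<gamma>': "Cardinal \<gamma>'" "\<gamma> \<in> elts \<gamma>'"
  have ord\<delta>: "Ordinal \<delta>"
    using \<delta> by (simp add: supreme_for_tallness_def Cardinal_def)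
  have wf: "wf_fm \<eta> \<tau> \<phi>"
    using \<phi> by (simp add: L_sentences_def)
  obtain l where l: "Cardinal l" "l \<in> elts \<eta>" "elts l \<noteq> {}" "index_sets_le (elts l) \<phi>"
    "all_vars \<phi> \<lesssim> elts l"
    using fm_bound[OF \<eta>(1) wf] by metis
  have "l \<in> elts \<delta>"
    using ord\<delta> l(2) \<eta>(2) by (rule Ordinal_mem_ord_le)
  then obtain \<kappa> where \<kappa>: "l \<in> elts \<kappa>" "tall_pushing_up \<gamma>' \<kappa> \<delta> l"
    using \<delta> l(1) Cardinal_Ordinal[OF \<gamma>'(1)] unfolding supreme_for_tallness_def by blast
  then obtain j M where j: "transitive_class M" "elementary_embedding j M" "critical_point j \<kappa>"
    "closed_under_sequences M l" "\<gamma>' \<in> elts (j \<delta>)"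
    unfolding tall_pushing_up_def by blast
  obtain v0 where v0: "inj_on v0 (all_vars \<phi>)" "v0 ` all_vars \<phi> \<subseteq> elts l"
    using l(5) by (auto simp: lepoll_def)
  obtain e where e: "e \<in> elts l"
    using l(3) by blast
  \<comment> \<open>Variables that do not occur in \<open>\<phi>\<close> get the default coordinate
    \<open>e\<close>, which makes \<open>v\<close> total.\<close>
  define v where "v x = (if x \<in> all_vars \<phi> then v0 x else e)" for x
  interpret ext: tall_extension j M \<kappa> l \<tau> A "all_vars \<phi>" v
    using j \<kappa>(1) A(1) v0 e by unfold_locales (auto simp: v_def inj_on_def)
  have "elts \<gamma>' \<subseteq> elts (j \<delta>)"
    using ext.j_transitive_set[of \<delta>] ord\<delta> j(5) by (auto simp: Ordinal_def transitive_set_def)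
  \<comment> \<open>\<open>A\<close> has at least \<open>\<delta>\<close> elements, so
    \<open>j A\<close> has at least as many as \<open>j \<delta>\<close>, which contains
    \<open>\<gamma>'\<close>.\<close>
  moreover have "elts \<delta> \<lesssim> elts (universe A)"
    using ord_le_subset[OF Cardinal_Ordinal[OF \<gamma>(1)] \<gamma>(3)] \<gamma>(2)
    by (meson eqpoll_imp_lepoll eqpoll_sym lepoll_trans subset_imp_lepoll)
  then have "elts (j \<delta>) \<lesssim> elts (j (universe A))"
    by (rule ext.lepoll_j)
  moreover have "elts (j (universe A)) \<lesssim> elts (universe ext.B)"
    using ext.bij_h by (auto simp: bij_betw_def lepoll_def)
  ultimately have "elts \<gamma>' \<lesssim> elts (universe ext.B)"
    by (meson lepoll_trans subset_imp_lepoll)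
  moreover have "L_models ext.B \<phi>"
    by (rule ext.L_models_B[OF wf l(4) _ A(2)]) simp
  ultimately show "\<exists>B. is_structure \<tau> B \<and> L_models B \<phi> \<and> elts \<gamma>' \<lesssim> elts (universe B) \<and> substructure \<tau> A B"
    using ext.structure_B ext.substructure_B by blast
qed

text \<open>
  The sentence saying that there are at most \<open>|\<gamma>|\<close> elements belongs to the logic when
  \<open>\<gamma> < \<delta>\<close>, and it has no model of size \<open>\<delta>\<close>.
\<close>

lemma ULST_property_lower_bound:
  fixes \<delta> \<nu> :: "'v::zfc_universe"
  assumes \<delta>: "regular_cardinal \<delta>" and \<nu>: "Cardinal \<nu>"
    and ULST: "ULST_property (L_sentences \<delta>) L_models \<nu>"
  shows "ord_le \<delta> \<nu>"
proof (rule ccontr)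
  assume no: "\<not> ord_le \<delta> \<nu>"
  have card: "Cardinal \<delta>" and inf: "infinite (elts \<delta>)"
    using \<delta> by (auto simp: regular_cardinal_def)
  note ord = Cardinal_Ordinal[OF card]
  have \<nu>\<delta>: "\<nu> \<in> elts \<delta>"
    using no Ordinal_linear[OF ord Cardinal_Ordinal[OF \<nu>]] by (auto simp: ord_le_def)
  \<comment> \<open>\<open>\<nu>\<close> may be 0, and structures are non-empty. A
    \<open>\<beta>\<close> above \<open>\<nu>\<close> leads to a non-empty \<open>\<gamma>\<close>
    that is still at least \<open>\<nu>\<close>.\<close>
  obtain \<beta> where \<beta>: "\<beta> \<in> elts \<delta>" "\<nu> \<in> elts \<beta>"
    using regular_max[OF \<delta> \<nu>\<delta> \<nu>\<delta>] by metis
  have ord\<beta>: "Ordinal \<beta>"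
    using ord \<beta>(1) by (rule Ordinal_in)
  obtain \<gamma> where \<gamma>: "Cardinal \<gamma>" "ord_le \<gamma> \<beta>" "elts \<gamma> \<approx> elts \<beta>"
    using ex_Cardinal_eqpoll[OF ord\<beta>] by metis
  have \<gamma>\<delta>: "\<gamma> \<in> elts \<delta>"
    using ord \<gamma>(2) \<beta>(1) by (rule ord_le_mem)
  have "\<gamma> \<notin> elts \<nu>"
  proof
    assume "\<gamma> \<in> elts \<nu>"
    with \<nu> have "elts \<gamma> \<prec> elts \<nu>"
      by (rule Cardinal_lesspoll)
    moreover have "elts \<nu> \<lesssim> elts \<gamma>"
      using Ordinal_subset[OF ord\<beta> \<beta>(2)] \<gamma>(3)
      by (meson eqpoll_imp_lepoll eqpoll_sym lepoll_trans subset_imp_lepoll)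
    ultimately show False
      using lesspoll_trans2 by blast
  qed
  then have \<nu>\<gamma>: "ord_le \<nu> \<gamma>"
    using Ordinal_linear[OF Cardinal_Ordinal[OF \<nu>] Cardinal_Ordinal[OF \<gamma>(1)]]
    by (auto simp: ord_le_def)
  have ne: "elts \<gamma> \<noteq> {}"
    using \<gamma>(3) \<beta>(2) by (auto simp: eqpoll_def bij_betw_def)
  define \<tau> :: "'v language" where
    "\<tau> = \<lparr>rel_syms = mkset {}, fun_syms = mkset {}, rel_arity = \<lambda>_. 0, fun_arity = \<lambda>_. 0\<rparr>"
  define A :: "'v struct" where
    "A = \<lparr>universe = \<gamma>, rel_int = \<lambda>_ _. False, fun_int = \<lambda>_ _. undefined\<rparr>"
  \<comment> \<open>The elements of \<open>\<gamma>\<close> serve as the existential variables, and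
    \<open>\<gamma>\<close> itself, which is not among them, as the universal one.\<close>
  define \<phi> where
    "\<phi> = Exists (elts \<gamma>) (Forall {\<gamma>} (Disj (elts \<gamma>) (\<lambda>\<alpha>. Eq (Var \<alpha>) (Var \<gamma>))))"
  have sat_\<phi>: "sat C \<phi> s \<longleftrightarrow> (\<exists>t. t ` elts \<gamma> \<subseteq> elts (universe C) \<and> elts (universe C) \<subseteq> t ` elts \<gamma>)"
    for C :: "'v struct" and s
  proof -
    \<comment> \<open>The inner quantifier ranges over whole functions \<open>y\<close> of which
      only the value at \<open>\<gamma>\<close> matters; constant functions realise every
      value.\<close>
    have eval: "(\<forall>y :: 'v \<Rightarrow> 'v. P (y \<gamma>)) \<longleftrightarrow> (\<forall>z. P z)" for P
    proof
      assume "\<forall>y :: 'v \<Rightarrow> 'v. P (y \<gamma>)"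
      then show "\<forall>z. P z"
        by (intro allI) (erule allE[of _ "\<lambda>_. z" for z])
    qed simp
    have "override_on (override_on s t (elts \<gamma>)) y {\<gamma>} \<alpha> = t \<alpha>" if "\<alpha> \<in> elts \<gamma>" for t y \<alpha>
      using that mem_irrefl[of \<gamma>] by (cases "\<alpha> = \<gamma>") (simp_all add: override_on_def)
    then have "sat C (Forall {\<gamma>} (Disj (elts \<gamma>) (\<lambda>\<alpha>. Eq (Var \<alpha>) (Var \<gamma>)))) (override_on s t (elts \<gamma>)) \<longleftrightarrow>
        (\<forall>y. y \<gamma> \<in> elts (universe C) \<longrightarrow> (\<exists>\<alpha>\<in>elts \<gamma>. t \<alpha> = y \<gamma>))" for t
      by (simp cong: bex_cong)
    also have "\<dots> t \<longleftrightarrow> elts (universe C) \<subseteq> t ` elts \<gamma>" for t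
      unfolding eval[of "\<lambda>z. z \<in> elts (universe C) \<longrightarrow> (\<exists>\<alpha>\<in>elts \<gamma>. t \<alpha> = z)"] by blast
    finally show ?thesis
      by (simp add: \<phi>_def)
  qed
  have "elts \<gamma> \<prec> elts \<delta>" "{\<gamma>} \<prec> elts \<delta>"
    using Cardinal_lesspoll[OF card \<gamma>\<delta>] inf by (auto intro: finite_lesspoll_infinite)
  then have "\<phi> \<in> L_sentences \<delta> \<tau>"
    by (auto simp: L_sentences_def \<phi>_def)
  moreover have "is_structure \<tau> A"
    using ne by (simp add: is_structure_def A_def \<tau>_def elts_mkset is_set_empty)
  moreover have "L_models A \<phi>"
    unfolding L_models_def sat_\<phi> by (auto simp: A_def intro!: exI[of _ "\<lambda>x. x"])
  moreover have "elts (universe A) \<approx> elts \<gamma>"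
    by (simp add: A_def)
  \<comment> \<open>The property is applied to a structure of size \<open>\<gamma>\<close>, with
    \<open>\<delta>\<close> as the required size.\<close>
  ultimately obtain C where C: "is_structure \<tau> C" "L_models C \<phi>" "elts \<delta> \<lesssim> elts (universe C)"
    using ULST \<gamma>(1) \<nu>\<gamma> card \<gamma>\<delta> unfolding ULST_property_def by blast
  obtain c where "c \<in> elts (universe C)"
    using C(1) by (auto simp: is_structure_def)
  then have "sat C \<phi> (\<lambda>_. c)"
    using C(2) by (auto simp: L_models_def)
  then have "elts (universe C) \<lesssim> elts \<gamma>"
    unfolding sat_\<phi> by (auto simp: lepoll_iff)
  then show False
    using C(3) \<open>elts \<gamma> \<prec> elts \<delta>\<close> by (meson lepoll_trans lesspoll_def lepoll_antisym)
qed

theorem theorem8p19: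
  fixes \<delta> :: "'v::zfc_universe"
  assumes "supreme_for_tallness \<delta>"
  shows "(\<forall>\<eta>. regular_cardinal \<eta> \<and> uncountable (elts \<eta>) \<and> ord_le \<eta> \<delta> \<longrightarrow>
            (\<exists>\<mu>. is_ULST (L_sentences \<eta>) L_models \<mu> \<and> ord_le \<mu> \<delta>)) \<and>
         (regular_cardinal \<delta> \<longrightarrow> is_ULST (L_sentences \<delta>) L_models \<delta>)"
proof (intro conjI allI impI)
  have card: "Cardinal \<delta>"
    using assms by (simp add: supreme_for_tallness_def)
  fix \<eta>
  assume \<eta>: "regular_cardinal \<eta> \<and> uncountable (elts \<eta>) \<and> ord_le \<eta> \<delta>"
  let ?Q = "{\<mu>. Cardinal \<mu> \<and> ULST_property (L_sentences \<eta>) L_models \<mu>}"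
  have \<delta>: "\<delta> \<in> ?Q"
    using card supreme_ULST_property[OF assms] \<eta> by simp
  \<comment> \<open>\<open>\<delta>\<close> witnesses that some cardinal has the property;
    foundation then gives a minimal one, which is least because ordinals are comparable.\<close>
  then obtain \<mu> where \<mu>: "\<mu> \<in> ?Q" and min: "\<And>\<nu>. \<nu> \<in> elts \<mu> \<Longrightarrow> \<nu> \<notin> ?Q"
    by (rule mem_minimalE) blast
  have "ord_le \<mu> \<nu>" if "\<nu> \<in> ?Q" for \<nu>
    using that \<mu> min Ordinal_linear[of \<mu> \<nu>] by (auto simp: ord_le_def dest: Cardinal_Ordinal)
  with \<mu> \<delta> show "\<exists>\<mu>. is_ULST (L_sentences \<eta>) L_models \<mu> \<and> ord_le \<mu> \<delta>"
    unfolding is_ULST_def by blast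
next
  assume "regular_cardinal \<delta>"
  then show "is_ULST (L_sentences \<delta>) L_models \<delta>"
    using supreme_ULST_property[OF assms] ULST_property_lower_bound assms
    by (auto simp: is_ULST_def supreme_for_tallness_def ord_le_def)
qed

end
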